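(* Let $p$ be a symmetric nc polynomial of degree $d$ in $g$ symmetric variables. If there is an $\epsilon>0$ such that the relaxed Hessian of $p$ is positive on the noncommutative $\epsilon$-neighborhood of $0$, then the degree of $p$ is at most two and $p$ is convex.
   Context: An nc polynomial is an element of the free algebra $\mathbb{R}\langle x\rangle$ in noncommuting variables $x_1,\dots,x_g$ with real coefficients. The involution $T$ is the linear map with $x_j^T=x_j$ (and $h_j^T=h_j$) that reverses words; $p$ is symmetric if $p^T=p$. $(\mathbb{R}^{n\times n}_{sym})^g$ is the set of $g$-tuples of real symmetric $n\times n$ matrices, at which nc polynomials are evaluated by substitution. $p'(x)[h]=\frac{d}{dt}p(x+th)|_{t=0}$ and $p''(x)[h]=\frac{d^2}{dt^2}p(x+th)|_{t=0}$ are nc polynomials in the $2g$ variables $x_1,\dots,x_g,h_1,\dots,h_g$. For $p$ of degree $d$ and $\lambda,\delta\in\mathbb{R}$, the relaxed Hessian is $$p''_{\lambda,\delta}(x)[h]=p''(x)[h]+\delta\sum_{j=1}^g\sum_{|m|\le d-1}m(x)^Th_j^2m(x)+\lambda\,p'(x)[h]^Tp'(x)[h],$$ where $m$ runs over all words in $x$ of length at most $d-1$. It is positive at $(X,v)\in(\mathbb{R}^{n\times n}_{sym})^g\times\mathbb{R}^n$ if for each $\delta>0$ there is a $\lambda>0$ such that $\langle p''_{\lambda,\delta}(X)[H]v,v\rangle\ge 0$ for all $H\in(\mathbb{R}^{n\times n}_{sym})^g$; it is positive on a graded set $S=\cup_{n\ge1}S_n$ with $S_n\subset(\mathbb{R}^{n\times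 n}_{sym})^g\times\mathbb{R}^n$ if it is positive at each $(X,v)\in S$. The noncommutative $\epsilon$-neighborhood of $0$ is $\mathcal U=\cup_{n\ge1}\mathcal U_n$ with $\mathcal U_n=\{(X,v): X\in(\mathbb{R}^{n\times n}_{sym})^g,\ \|X\|<\epsilon,\ v\in\mathbb{R}^n\}$, where $\|\cdot\|$ is any norm on $(\mathbb{R}^{n\times n}_{sym})^g$. A symmetric nc polynomial $p$ is (matrix) convex if $p(tX+(1-t)Y)\preceq tp(X)+(1-t)p(Y)$ for every $n$, all $X,Y\in(\mathbb{R}^{n\times n}_{sym})^g$ and $0\le t\le1$. *)

theory Defs
  imports
    "HOL-Library.Poly_Mapping"
    "HOL-Analysis.Derivative"
    "Jordan_Normal_Form.Matrix"
begin

no_notation inner (infix \<open>\<bullet>\<close> 70)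

section \<open>The free algebra\<close>

text \<open>Words are lists, made into the free monoid (written additively, as \<open>Poly_Mapping\<close>
  expects). The convolution product on finitely supported functions from words to the reals
  is then the product of the free algebra.\<close>

instantiation list :: (type) monoid_add
begin

definition zero_list :: "'a list" where "zero_list = []"

definition plus_list :: "'a list \<Rightarrow> 'a list \<Rightarrow> 'a list" where "plus_list u w = u @ w"

instance by standard (simp_all add: zero_list_def plus_list_def)

end

type_synonym 'v ncpoly = "'v list \<Rightarrow>\<^sub>0 real"

definition nc_const :: "real \<Rightarrow> 'v ncpoly" where
  "nc_const c = Poly_Mapping.single [] c"

definition nc_word :: "'v list \<Rightarrow> 'v ncpoly" where
  "nc_word w = Poly_Mapping.single w 1"

definition nc_var :: "'v \<Rightarrow> 'v ncpoly" where
  "nc_var v = nc_word [v]"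

definition nc_degree :: "'v ncpoly \<Rightarrow> nat" where
  "nc_degree p = Max (insert 0 (length ` Poly_Mapping.keys p))"

definition nc_transpose :: "'v ncpoly \<Rightarrow> 'v ncpoly" where
  "nc_transpose p = Poly_Mapping.map_key rev p"

definition nc_symmetric :: "'v ncpoly \<Rightarrow> bool" where
  "nc_symmetric p \<longleftrightarrow> nc_transpose p = p"

definition nc_subst :: "('v \<Rightarrow> 'u ncpoly) \<Rightarrow> 'v ncpoly \<Rightarrow> 'u ncpoly" where
  "nc_subst f p =
     (\<Sum>w\<in>Poly_Mapping.keys p. nc_const (Poly_Mapping.lookup p w) * prod_list (map f w))"

section \<open>Directional derivatives\<close>

text \<open>Polynomials in $x$ and $h$ have variables of type \<open>'g + 'g\<close>: \<open>Inl j\<close> is $x_j$ and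
  \<open>Inr j\<close> is $h_j$.\<close>

definition nc_shift :: "real \<Rightarrow> 'g ncpoly \<Rightarrow> ('g + 'g) ncpoly" where
  "nc_shift t p = nc_subst (\<lambda>j. nc_var (Inl j) + nc_const t * nc_var (Inr j)) p"

text \<open>The \<open>k\<close>-th derivative of $p(x+th)$ in \<open>t\<close> at \<open>t = 0\<close>, taken coefficient by coefficient.\<close>

definition nc_deriv :: "nat \<Rightarrow> 'g ncpoly \<Rightarrow> ('g + 'g) ncpoly" where
  "nc_deriv k p = Poly_Mapping.Abs_poly_mapping
     (\<lambda>w. (deriv ^^ k) (\<lambda>t. Poly_Mapping.lookup (nc_shift t p) w) 0)"

text \<open>The argument of \<open>Abs_poly_mapping\<close> does have finite support.\<close>

lemma length_keys_mult:
  assumes "\<And>u. u \<in> Poly_Mapping.keys p \<Longrightarrow> length u \<le> a"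
    and "\<And>u. u \<in> Poly_Mapping.keys q \<Longrightarrow> length u \<le> b"
    and "w \<in> Poly_Mapping.keys (p * q :: 'v ncpoly)"
  shows "length w \<le> a + b"
proof -
  obtain u v where "u \<in> Poly_Mapping.keys p" "v \<in> Poly_Mapping.keys q" "w = u + v"
    using keys_mult[of p q] assms(3) by blast
  then show ?thesis
    using assms(1)[of u] assms(2)[of v] by (simp add: plus_list_def)
qed

lemma length_keys_const_mult:
  assumes "\<And>u. u \<in> Poly_Mapping.keys p \<Longrightarrow> length u \<le> a"
    and "w \<in> Poly_Mapping.keys (nc_const c * p :: 'v ncpoly)"
  shows "length w \<le> a"
proof -
  have "u \<in> Poly_Mapping.keys (nc_const c) \<Longrightarrow> length u \<le> 0" for u :: "'v list"
    by (simp add: nc_const_def split: if_splits)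
  from length_keys_mult[OF this assms] show ?thesis by simp
qed

lemma length_keys_shift_var:
  assumes "w \<in> Poly_Mapping.keys (nc_var (Inl j) + nc_const t * nc_var (Inr j) :: ('g + 'g) ncpoly)"
  shows "length w \<le> 1"
proof -
  have *: "u \<in> Poly_Mapping.keys (nc_var v) \<Longrightarrow> length u \<le> 1" for u :: "('g + 'g) list" and v
    by (simp add: nc_var_def nc_word_def)
  consider "w \<in> Poly_Mapping.keys (nc_var (Inl j))"
    | "w \<in> Poly_Mapping.keys (nc_const t * nc_var (Inr j))"
    using assms Poly_Mapping.keys_add[of "nc_var (Inl j)" "nc_const t * nc_var (Inr j)"] by blast
  then show ?thesis
  proof cases
    case 1
    then show ?thesis by (rule *)
  next
    case 2
    then show ?thesis by (rule length_keys_const_mult[rotated]) (rule *)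
  qed
qed

lemma length_keys_prod_list:
  assumes "\<And>j u. u \<in> Poly_Mapping.keys (f j) \<Longrightarrow> length u \<le> 1"
  shows "w \<in> Poly_Mapping.keys (prod_list (map f m) :: 'v ncpoly) \<Longrightarrow> length w \<le> length m"
proof (induction m arbitrary: w)
  case Nil
  then show ?case by (simp add: zero_list_def)
next
  case (Cons j m)
  have "length w \<le> 1 + length m"
    using Cons.prems by (intro length_keys_mult[OF assms Cons.IH]) auto
  then show ?case by simp
qed

lemma length_keys_shift:
  assumes "w \<in> Poly_Mapping.keys (nc_shift t p)"
  shows "length w \<le> nc_degree p"
proof -
  let ?f = "\<lambda>j. nc_var (Inl j) + nc_const t * nc_var (Inr j) :: ('a + 'a) ncpoly"
  obtain m where m: "m \<in> Poly_Mapping.keys p"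
    and w: "w \<in> Poly_Mapping.keys (nc_const (Poly_Mapping.lookup p m) * prod_list (map ?f m))"
    using assms Poly_Mapping.keys_sum[of
      "\<lambda>m. nc_const (Poly_Mapping.lookup p m) * prod_list (map ?f m)" "Poly_Mapping.keys p"]
    unfolding nc_shift_def nc_subst_def by blast
  have "length w \<le> length m"
    by (rule length_keys_const_mult[OF length_keys_prod_list[OF length_keys_shift_var] w])
  also have "\<dots> \<le> nc_degree p"
    unfolding nc_degree_def using m by (intro Max_ge) auto
  finally show ?thesis .
qed

lemma iterated_deriv_zero: "(deriv ^^ k) (\<lambda>t::real. 0::real) = (\<lambda>t. 0)"
  by (induction k) auto

lemma lookup_nc_deriv:
  fixes p :: "'g::finite ncpoly"
  shows "Poly_Mapping.lookup (nc_deriv k p) w =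
    (deriv ^^ k) (\<lambda>t. Poly_Mapping.lookup (nc_shift t p) w) 0"
proof -
  let ?c = "\<lambda>w. (deriv ^^ k) (\<lambda>t. Poly_Mapping.lookup (nc_shift t p) w) 0"
  have "?c w = 0" if "\<not> length w \<le> nc_degree p" for w
  proof -
    have "Poly_Mapping.lookup (nc_shift t p) w = 0" for t
      using length_keys_shift[of w t p] that by (meson in_keys_iff)
    then show ?thesis by (simp add: iterated_deriv_zero)
  qed
  then have "{w. ?c w \<noteq> 0} \<subseteq> {w. set w \<subseteq> UNIV \<and> length w \<le> nc_degree p}" by auto
  then have "finite {w. ?c w \<noteq> 0}"
    by (rule finite_subset) (rule finite_lists_length_le, rule finite)
  then show ?thesis unfolding nc_deriv_def by simp
qed

section \<open>The relaxed Hessian\<close>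

text \<open>The condition $|m| \le d-1$ is written $|m| < d$, which avoids truncated subtraction
  for $d = 0$.\<close>

definition relaxed_hessian :: "real \<Rightarrow> real \<Rightarrow> 'g::finite ncpoly \<Rightarrow> ('g + 'g) ncpoly" where
  "relaxed_hessian lam \<delta> p =
     nc_deriv 2 p
     + nc_const \<delta> * (\<Sum>j\<in>UNIV. \<Sum>m | length m < nc_degree p.
         nc_transpose (nc_word (map Inl m)) * nc_var (Inr j) ^ 2 * nc_word (map Inl m))
     + nc_const lam * (nc_transpose (nc_deriv 1 p) * nc_deriv 1 p)"

section \<open>Evaluation at matrices\<close>

text \<open>A \<open>g\<close>-tuple is a function on the finite type \<open>'g\<close>; the size \<open>n\<close> is explicit since it is
  quantified inside the statements.\<close>

definition sym_tuples :: "nat \<Rightarrow> ('g \<Rightarrow> real mat) set" where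
  "sym_tuples n = {X. \<forall>j. X j \<in> carrier_mat n n \<and> transpose_mat (X j) = X j}"

definition word_eval :: "nat \<Rightarrow> ('v \<Rightarrow> real mat) \<Rightarrow> 'v list \<Rightarrow> real mat" where
  "word_eval n X w = foldr (\<lambda>v A. X v * A) w (1\<^sub>m n)"

definition nc_eval :: "nat \<Rightarrow> ('v \<Rightarrow> real mat) \<Rightarrow> 'v ncpoly \<Rightarrow> real mat" where
  "nc_eval n X p = mat n n
     (\<lambda>(i, j). \<Sum>w\<in>Poly_Mapping.keys p. Poly_Mapping.lookup p w * word_eval n X w $$ (i, j))"

definition relaxed_hessian_positive_at ::
    "'g::finite ncpoly \<Rightarrow> nat \<Rightarrow> ('g \<Rightarrow> real mat) \<times> real vec \<Rightarrow> bool" where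
  "relaxed_hessian_positive_at p n = (\<lambda>(X, v).
     \<forall>\<delta>>0. \<exists>lam>0. \<forall>H\<in>sym_tuples n.
       (nc_eval n (case_sum X H) (relaxed_hessian lam \<delta> p) *\<^sub>v v) \<bullet> v \<ge> 0)"

definition relaxed_hessian_positive_on ::
    "'g::finite ncpoly \<Rightarrow> (nat \<Rightarrow> (('g \<Rightarrow> real mat) \<times> real vec) set) \<Rightarrow> bool" where
  "relaxed_hessian_positive_on p S \<longleftrightarrow>
     (\<forall>n\<ge>1. \<forall>Xv\<in>S n. relaxed_hessian_positive_at p n Xv)"

definition norm_on_sym_tuples :: "nat \<Rightarrow> (('g \<Rightarrow> real mat) \<Rightarrow> real) \<Rightarrow> bool" where
  "norm_on_sym_tuples n N \<longleftrightarrow>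
     (\<forall>X\<in>sym_tuples n. 0 \<le> N X \<and> (N X = 0 \<longleftrightarrow> X = (\<lambda>j. 0\<^sub>m n n))) \<and>
     (\<forall>c. \<forall>X\<in>sym_tuples n. N (\<lambda>j. c \<cdot>\<^sub>m X j) = \<bar>c\<bar> * N X) \<and>
     (\<forall>X\<in>sym_tuples n. \<forall>Y\<in>sym_tuples n. N (\<lambda>j. X j + Y j) \<le> N X + N Y)"

definition nc_neighborhood ::
    "(nat \<Rightarrow> ('g \<Rightarrow> real mat) \<Rightarrow> real) \<Rightarrow> real \<Rightarrow> nat \<Rightarrow> (('g \<Rightarrow> real mat) \<times> real vec) set" where
  "nc_neighborhood N \<epsilon> n = {(X, v). X \<in> sym_tuples n \<and> N n X < \<epsilon> \<and> v \<in> carrier_vec n}"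

definition psd :: "nat \<Rightarrow> real mat \<Rightarrow> bool" where
  "psd n A \<longleftrightarrow> A \<in> carrier_mat n n \<and> transpose_mat A = A \<and>
     (\<forall>v\<in>carrier_vec n. (A *\<^sub>v v) \<bullet> v \<ge> 0)"

definition nc_convex :: "'g ncpoly \<Rightarrow> bool" where
  "nc_convex p \<longleftrightarrow> (\<forall>n\<ge>1. \<forall>X\<in>sym_tuples n. \<forall>Y\<in>sym_tuples n. \<forall>t. 0 \<le> t \<and> t \<le> 1 \<longrightarrow>
     psd n (t \<cdot>\<^sub>m nc_eval n X p + (1 - t) \<cdot>\<^sub>m nc_eval n Y p
       - nc_eval n (\<lambda>j. t \<cdot>\<^sub>m X j + (1 - t) \<cdot>\<^sub>m Y j) p))"

end

theory Submission
  imports Defs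
begin

text \<open>Let \<open>M\<close> be the Hankel matrix of \<open>p\<close>, indexed by the nonempty words of length at most \<open>d\<close>,
  whose entry at \<open>(\<alpha>, \<beta>)\<close> is the coefficient of \<open>p\<close> at the word \<open>\<alpha>\<^sup>T\<beta>\<close>, and let \<open>l\<close> be the
  vector of coefficients of \<open>p\<close> at these words. Choose a small tuple \<open>X\<close> acting on a truncated Fock
  space with vacuum \<open>v\<close> and annihilating an additional unit vector \<open>k\<close> orthogonal to it. The vectors
  \<open>m(X) v\<close> with \<open>|m| < d\<close> are independent, so for each function \<open>F\<close> on words there are vectors
  \<open>\<phi>\<^sub>j\<close> orthogonal to \<open>k\<close> with \<open>\<langle>\<phi>\<^sub>j, m(X) v\<rangle> = F (x\<^sub>j m)\<close>. In the direction
  \<open>H\<^sub>j = k \<phi>\<^sub>j\<^sup>T + \<phi>\<^sub>j k\<^sup>T\<close> one finds \<open>p'(X)[H] v = l(F) k\<close> and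
  \<open>\<langle>p''(X)[H] v, v\<rangle> = 2 \<langle>M F, F\<rangle>\<close>. As \<open>H\<close> does not depend on \<open>\<delta>\<close>, positivity of
  the relaxed Hessian makes \<open>M\<close> nonnegative on the kernel of \<open>l\<close>. If \<open>\<gamma>\<close> is a word of length \<open>d\<close>
  in \<open>p\<close>, then row \<open>\<gamma>\<close> of \<open>M\<close> vanishes while \<open>l(\<gamma>) \<noteq> 0\<close>, so the constraint can be met by
  changing \<open>F\<close> at \<open>\<gamma>\<close> only, and \<open>M\<close> is nonnegative everywhere. For \<open>d > 2\<close> this contradicts the
  anti-triangular shape of \<open>M\<close>; for \<open>d \<le> 2\<close> it says that the quadratic part of \<open>p\<close> is
  positive semidefinite, which is convexity.\<close>

no_notation vec_nth (infixl "$" 90)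

section \<open>Coefficients of products, shifts and derivatives in the free algebra\<close>

lemma ncpoly_induct [case_names single add]:
  assumes single: "\<And>w c. P (Poly_Mapping.single w c)"
    and add: "\<And>p q. P p \<Longrightarrow> P q \<Longrightarrow> P (p + q)"
  shows "P (p :: 'v ncpoly)"
proof -
  have "P (\<Sum>w\<in>A. Poly_Mapping.single w (Poly_Mapping.lookup p w))" if "finite A" for A
    using that
  proof (induction A)
    case empty
    \<comment> \<open>The zero polynomial is a monomial with coefficient 0, so the induction rule
      needs no case of its own for it.\<close>
    show ?case using single[of undefined 0] by simp
  qed (simp add: single add)
  moreover have "(\<Sum>w\<in>Poly_Mapping.keys p. Poly_Mapping.single w (Poly_Mapping.lookup p w)) = p"
    by (rule poly_mapping_eqI)
       (auto simp: lookup_sum lookup_single when_def in_keys_iff if_distrib sum.delta cong: if_cong)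
  ultimately show ?thesis by (metis finite_keys)
qed

lemma lookup_const_mult: "Poly_Mapping.lookup (nc_const c * p) w = c * Poly_Mapping.lookup p w"
  for p :: "'v ncpoly"
  by (induction p rule: ncpoly_induct)
     (simp_all add: nc_const_def mult_single plus_list_def lookup_single when_def algebra_simps lookup_add)

lemma lookup_var_mult:
  "Poly_Mapping.lookup (nc_var v * p) w
    = (case w of [] \<Rightarrow> 0 | u # w' \<Rightarrow> if u = v then Poly_Mapping.lookup p w' else 0)"
  for p :: "'v ncpoly"
  by (induction p rule: ncpoly_induct)
     (auto simp: nc_var_def nc_word_def mult_single plus_list_def lookup_single when_def algebra_simps
       lookup_add split: list.splits)

text \<open>The coefficient of \<open>nc_shift t p\<close> at a word in x and h, and likewise that
  of each derivative, depends only on the word in x obtained by forgetting which letters are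
  directions and on the number of direction letters.\<close>

definition strip :: "('g + 'g) list \<Rightarrow> 'g list" where
  "strip = map (case_sum id id)"

definition hcount :: "('g + 'g) list \<Rightarrow> nat" where
  "hcount w = length (filter (\<lambda>x. \<not> isl x) w)"

lemma strip_simps [simp]: "strip [] = []" "strip (Inl j # w) = j # strip w"
  "strip (Inr j # w) = j # strip w" "strip (u @ w) = strip u @ strip w" "strip (map Inl m) = m"
  "strip (rev w) = rev (strip w)" "length (strip w) = length w"
  by (auto simp: strip_def rev_map o_def)

lemma hcount_simps [simp]: "hcount [] = 0" "hcount (Inl j # w) = hcount w"
  "hcount (Inr j # w) = Suc (hcount w)" "hcount (u @ w) = hcount u + hcount w"
  "hcount (map Inl m) = 0" "hcount (rev w) = hcount w"
  by (auto simp: hcount_def rev_filter[symmetric])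

text \<open>Expanding the product, each choice of x or th at every letter of \<open>m\<close> yields
  a different word, so no two terms collide, and every direction letter contributes one factor
  t.\<close>

lemma lookup_shift_word:
  "Poly_Mapping.lookup
     (prod_list (map (\<lambda>j. nc_var (Inl j) + nc_const t * nc_var (Inr j) :: ('g + 'g) ncpoly) m)) w
    = (if strip w = m then t ^ hcount w else 0)"
proof (induction m arbitrary: w)
  case Nil
  then show ?case by (auto simp: lookup_one zero_list_def when_def strip_def)
next
  case (Cons j m)
  then show ?case
    by (cases w rule: list.exhaust; cases "hd w")
       (auto simp: distrib_right lookup_add mult.assoc lookup_const_mult lookup_var_mult)
qed

lemma lookup_shift:
  "Poly_Mapping.lookup (nc_shift t p) w = t ^ hcount w * Poly_Mapping.lookup p (strip w)"
  unfolding nc_shift_def nc_subst_def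
  by (auto simp: lookup_sum lookup_const_mult lookup_shift_word if_distrib sum.delta' in_keys_iff
      cong: if_cong)

text \<open>The product is a falling factorial. Truncated subtraction does no harm: for k > m the
  factor at i = m is 0.\<close>

lemma iterated_deriv_power:
  "(deriv ^^ k) (\<lambda>t::real. t ^ m * c) = (\<lambda>t. (\<Prod>i<k. real (m - i)) * t ^ (m - k) * c)"
proof (induction k)
  case (Suc k)
  have "deriv (\<lambda>t. (\<Prod>i<k. real (m - i)) * t ^ (m - k) * c) t
      = (\<Prod>i<Suc k. real (m - i)) * t ^ (m - Suc k) * c" for t
    by (rule DERIV_imp_deriv) (auto intro!: derivative_eq_intros)
  with Suc show ?case by auto
qed simp

lemma lookup_deriv:
  fixes p :: "'g::finite ncpoly"
  shows "Poly_Mapping.lookup (nc_deriv k p) w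
    = (if hcount w = k then fact k * Poly_Mapping.lookup p (strip w) else 0)"
proof -
  \<comment> \<open>At t = 0 only the exponent k survives: smaller ones are killed by the falling
    factorial, larger ones by the remaining power of 0.\<close>
  have "(\<Prod>i<k. real (m - i)) * 0 ^ (m - k) = (if m = k then fact k else 0)" for m
  proof (cases "m \<le> k")
    case True
    then show ?thesis
      by (auto simp: fact_prod_rev atLeast0LessThan)
  qed auto
  then show ?thesis
    by (simp add: lookup_nc_deriv lookup_shift iterated_deriv_power)
qed

section \<open>Evaluation at matrices as a homomorphism compatible with transposition\<close>

lemma word_eval_Nil [simp]: "word_eval n Y [] = 1\<^sub>m n"
  and word_eval_Cons [simp]: "word_eval n Y (j # w) = Y j * word_eval n Y w"
  by (simp_all add: word_eval_def)

lemma word_eval_carrier [simp]: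
  assumes "\<And>j. Y j \<in> carrier_mat n n"
  shows "word_eval n Y w \<in> carrier_mat n n"
proof (induction w)
  case (Cons j w)
  then show ?case using assms[of j] by simp
qed simp

lemma word_eval_append:
  assumes Y: "\<And>j. Y j \<in> carrier_mat n n"
  shows "word_eval n Y (u @ w) = word_eval n Y u * word_eval n Y w"
proof (induction u)
  case Nil
  then show ?case using word_eval_carrier[of Y n w, OF Y] by simp
next
  case (Cons j u)
  then show ?case
    using assoc_mult_mat[OF Y word_eval_carrier[of Y, OF Y] word_eval_carrier[of Y, OF Y]] by simp
qed

lemma nc_eval_carrier [simp]: "nc_eval n Y p \<in> carrier_mat n n"
  by (simp add: nc_eval_def)

text \<open>Any finite set containing the support may serve as index set, so that several
  polynomials can be summed over a common one.\<close>

lemma nc_eval_index: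
  assumes "finite S" "Poly_Mapping.keys p \<subseteq> S" "i < n" "j < n"
  shows "nc_eval n Y p $$ (i, j) = (\<Sum>w\<in>S. Poly_Mapping.lookup p w * word_eval n Y w $$ (i, j))"
  using assms unfolding nc_eval_def
  by (auto intro!: sum.mono_neutral_left simp: in_keys_iff)

lemma nc_eval_add: "nc_eval n Y (p + q) = nc_eval n Y p + nc_eval n Y q"
proof (rule eq_matI)
  fix i j assume "i < dim_row (nc_eval n Y p + nc_eval n Y q)" "j < dim_col (nc_eval n Y p + nc_eval n Y q)"
  then have ij: "i < n" "j < n" by (simp_all add: nc_eval_def)
  let ?S = "Poly_Mapping.keys p \<union> Poly_Mapping.keys q"
  have "nc_eval n Y r $$ (i, j) = (\<Sum>w\<in>?S. Poly_Mapping.lookup r w * word_eval n Y w $$ (i, j))"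
    if "r \<in> {p, q, p + q}" for r
    using that keys_add[of p q] ij by (intro nc_eval_index) auto
  then show "nc_eval n Y (p + q) $$ (i, j) = (nc_eval n Y p + nc_eval n Y q) $$ (i, j)"
    using ij carrier_matD[OF nc_eval_carrier[of n Y q]]
    by (simp add: lookup_add sum.distrib distrib_right)
qed (simp_all add: nc_eval_def)

lemma nc_eval_single:
  assumes "\<And>j. Y j \<in> carrier_mat n n"
  shows "nc_eval n Y (Poly_Mapping.single w c) = c \<cdot>\<^sub>m word_eval n Y w"
  using word_eval_carrier[of Y n w, OF assms]
  by (intro eq_matI) (auto simp: nc_eval_def)

lemma smult_smult_mat: "a \<cdot>\<^sub>m (b \<cdot>\<^sub>m A) = (a * b) \<cdot>\<^sub>m (A :: 'a::semiring_1 mat)"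
  by (intro eq_matI) (auto simp: mult.assoc)

lemma nc_eval_mult:
  assumes Y: "\<And>j. Y j \<in> carrier_mat n n"
  shows "nc_eval n Y (p * q) = nc_eval n Y p * nc_eval n Y q"
proof (induction p rule: ncpoly_induct)
  case (single u c)
  show ?case
  proof (induction q rule: ncpoly_induct)
    case (single w b)
    show ?case
      using word_eval_carrier[of Y n, OF Y]
      by (simp add: mult_single nc_eval_single[of Y, OF Y] plus_list_def word_eval_append[of Y, OF Y]
          mult_smult_assoc_mat[of _ n n _ n] mult_smult_distrib[of _ n n _ n] smult_smult_mat mult.commute)
  qed (simp add: distrib_left nc_eval_add mult_add_distrib_mat[of _ n n _ n])
qed (simp add: distrib_right nc_eval_add add_mult_distrib_mat[of _ n n _ _ n])

lemma nc_eval_const_mult: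
  assumes Y: "\<And>j. Y j \<in> carrier_mat n n"
  shows "nc_eval n Y (nc_const c * p) = c \<cdot>\<^sub>m nc_eval n Y p"
  by (simp add: nc_eval_mult[of Y, OF Y] nc_const_def nc_eval_single[of Y, OF Y]
      mult_smult_assoc_mat[of _ n n _ n] left_mult_one_mat[of _ n n])

lemma nc_eval_scalar_prod:
  assumes Y: "\<And>j. Y j \<in> carrier_mat n n" and v: "v \<in> carrier_vec n" and u: "u \<in> carrier_vec n"
    and S: "finite S" "Poly_Mapping.keys p \<subseteq> S"
  shows "(nc_eval n Y p *\<^sub>v v) \<bullet> u
    = (\<Sum>w\<in>S. Poly_Mapping.lookup p w * ((word_eval n Y w *\<^sub>v v) \<bullet> u))"
proof -
  have quad: "(A *\<^sub>v v) \<bullet> u = (\<Sum>i<n. \<Sum>j<n. A $$ (i, j) * v $ j * u $ i)"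
    if "A \<in> carrier_mat n n" for A :: "real mat"
    using that u v by (simp add: scalar_prod_def sum_distrib_right atLeast0LessThan)
  have "(nc_eval n Y p *\<^sub>v v) \<bullet> u
      = (\<Sum>i<n. \<Sum>j<n. \<Sum>w\<in>S. Poly_Mapping.lookup p w * word_eval n Y w $$ (i, j) * v $ j * u $ i)"
    by (simp add: quad nc_eval_index[OF S] sum_distrib_right)
  also have "\<dots> = (\<Sum>i<n. \<Sum>w\<in>S. \<Sum>j<n. Poly_Mapping.lookup p w * word_eval n Y w $$ (i, j) * v $ j * u $ i)"
    by (intro sum.cong refl) (rule sum.swap)
  also have "\<dots> = (\<Sum>w\<in>S. \<Sum>i<n. \<Sum>j<n. Poly_Mapping.lookup p w * word_eval n Y w $$ (i, j) * v $ j * u $ i)"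
    by (rule sum.swap)
  also have "\<dots> = (\<Sum>w\<in>S. Poly_Mapping.lookup p w * ((word_eval n Y w *\<^sub>v v) \<bullet> u))"
    using word_eval_carrier[of Y n, OF Y] by (simp add: quad sum_distrib_left mult.assoc)
  finally show ?thesis .
qed

lemma word_eval_rev:
  assumes X: "X \<in> sym_tuples n"
  shows "word_eval n X (rev w) = transpose_mat (word_eval n X w)"
proof (induction w)
  case (Cons j w)
  have Xc: "\<And>j. X j \<in> carrier_mat n n" and Xt: "transpose_mat (X j) = X j"
    using X by (auto simp: sym_tuples_def)
  show ?case
    using Cons transpose_mult[OF Xc word_eval_carrier[of X, OF Xc], of j w] right_mult_one_mat[OF Xc]
    by (simp add: word_eval_append[of X, OF Xc] Xt)
qed simp

lemma word_eval_adjoint: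
  assumes X: "X \<in> sym_tuples n" and x: "x \<in> carrier_vec n" and y: "y \<in> carrier_vec n"
  shows "(word_eval n X w *\<^sub>v x) \<bullet> y = x \<bullet> (word_eval n X (rev w) *\<^sub>v y)"
proof -
  have W: "word_eval n X w \<in> carrier_mat n n"
    using X by (intro word_eval_carrier) (auto simp: sym_tuples_def)
  show ?thesis
    using transpose_vec_mult_scalar[of "transpose_mat (word_eval n X w)" n n y x] W x y
    by (simp add: word_eval_rev[OF X])
qed

section \<open>The Hankel form of a polynomial\<close>

lemma lookup_above_degree: "nc_degree p < length w \<Longrightarrow> Poly_Mapping.lookup p w = 0"
  using Max_ge[of "insert 0 (length ` Poly_Mapping.keys p)" "length w"]
  unfolding nc_degree_def by (force simp: in_keys_iff)

lemma degree_attained: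
  assumes "nc_degree p > 0"
  obtains w where "Poly_Mapping.lookup p w \<noteq> 0" "length w = nc_degree p"
proof -
  have "nc_degree p \<in> insert 0 (length ` Poly_Mapping.keys p)"
    unfolding nc_degree_def by (rule Max_in) auto
  with assms that show ?thesis by (auto simp: in_keys_iff)
qed

lemma lookup_transpose: "Poly_Mapping.lookup (nc_transpose p) w = Poly_Mapping.lookup p (rev w)"
  by (simp add: nc_transpose_def map_key.rep_eq)

lemma lookup_symmetric: "nc_symmetric p \<Longrightarrow> Poly_Mapping.lookup p (rev w) = Poly_Mapping.lookup p w"
  using lookup_transpose[of p w] by (simp add: nc_symmetric_def)

lemma finite_words_less [simp]: "finite {w :: 'v::finite list. length w < k}"
  by (rule finite_subset[OF _ finite_lists_length_le[of UNIV k]]) auto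

lemma finite_words_le [simp]: "finite {w :: 'v::finite list. length w \<le> k}"
  using finite_lists_length_le[of "UNIV :: 'v set" k] by simp

text \<open>An index \<open>j # m\<close> stands for the direction letter \<open>Inr j\<close> in
  front of the word m in x. The empty word carries no direction letter and is left out.\<close>

definition index_words :: "nat \<Rightarrow> 'g list set" where
  "index_words d = {w. w \<noteq> [] \<and> length w \<le> d}"

lemma finite_index_words [simp]: "finite (index_words d :: 'g::finite list set)"
  unfolding index_words_def by (rule finite_subset[OF _ finite_words_le[of d]]) auto

definition hankel_form :: "'g::finite ncpoly \<Rightarrow> ('g list \<Rightarrow> real) \<Rightarrow> real" where
  "hankel_form p F = (\<Sum>\<alpha>\<in>index_words (nc_degree p). \<Sum>\<beta>\<in>index_words (nc_degree p).
     Poly_Mapping.lookup p (rev \<alpha> @ \<beta>) * F \<alpha> * F \<beta>)"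

text \<open>The coordinate at \<gamma> does not enter the form, but it does enter the linear
  constraint; hence every \<open>F\<close> can be moved into the kernel along \<gamma> without
  changing the value of the form.\<close>

lemma hankel_form_nonneg:
  fixes p :: "'g::finite ncpoly"
  assumes \<gamma>: "Poly_Mapping.lookup p \<gamma> \<noteq> 0" "length \<gamma> = nc_degree p" "\<gamma> \<noteq> []"
    and nonneg: "\<And>F. (\<Sum>\<alpha>\<in>index_words (nc_degree p). Poly_Mapping.lookup p \<alpha> * F \<alpha>) = 0
      \<Longrightarrow> 0 \<le> hankel_form p F"
  shows "0 \<le> hankel_form p F"
proof -
  let ?W = "index_words (nc_degree p) :: 'g list set"
  define l where "l = (\<lambda>F. \<Sum>\<alpha>\<in>?W. Poly_Mapping.lookup p \<alpha> * F \<alpha>)"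
  define c where "c = - l F / Poly_Mapping.lookup p \<gamma>"
  define G where "G = F(\<gamma> := F \<gamma> + c)"
  have "l G = (\<Sum>\<alpha>\<in>?W. Poly_Mapping.lookup p \<alpha> * F \<alpha> + (if \<alpha> = \<gamma> then Poly_Mapping.lookup p \<gamma> * c else 0))"
    unfolding l_def G_def by (intro sum.cong) (auto simp: algebra_simps)
  also have "\<dots> = l F + Poly_Mapping.lookup p \<gamma> * c"
    using \<gamma> by (simp add: l_def sum.distrib index_words_def[of "nc_degree p"])
  also have "\<dots> = 0" using \<gamma> by (simp add: c_def)
  finally have "0 \<le> hankel_form p G" using nonneg by (simp add: l_def)
  also have "hankel_form p G = hankel_form p F"
    unfolding hankel_form_def
  proof (intro sum.cong refl)
    fix \<alpha> \<beta> :: "'g list"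
    assume "\<alpha> \<in> ?W" "\<beta> \<in> ?W"
    \<comment> \<open>The other index is nonempty, so the concatenated word is longer than the
      degree.\<close>
    then have "Poly_Mapping.lookup p (rev \<alpha> @ \<beta>) = 0" if "\<alpha> = \<gamma> \<or> \<beta> = \<gamma>"
      using that \<gamma> by (intro lookup_above_degree) (auto simp: index_words_def)
    then show "Poly_Mapping.lookup p (rev \<alpha> @ \<beta>) * G \<alpha> * G \<beta> = Poly_Mapping.lookup p (rev \<alpha> @ \<beta>) * F \<alpha> * F \<beta>"
      by (auto simp: G_def)
  qed
  finally show ?thesis .
qed

text \<open>For \<open>d > 2\<close> the diagonal entry at a word of length \<open>d - 1\<close> vanishes, but some
  off-diagonal entry in its row does not.\<close>

lemma degree_le_2:
  fixes p :: "'g::finite ncpoly"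
  assumes sym: "nc_symmetric p" and nonneg: "\<And>F. 0 \<le> hankel_form p F"
  shows "nc_degree p \<le> 2"
proof (rule ccontr)
  let ?W = "index_words (nc_degree p) :: 'g list set"
  assume "\<not> nc_degree p \<le> 2"
  then have d: "nc_degree p > 2" by simp
  then obtain w where w: "Poly_Mapping.lookup p w \<noteq> 0" "length w = nc_degree p"
    using degree_attained[of p] by auto
  with d obtain i \<beta> where w_eq: "w = i # \<beta>" by (cases w) auto
  define a b where "a = Poly_Mapping.lookup p [i, i]" and "b = Poly_Mapping.lookup p w"
  \<comment> \<open>The form at \<open>F\<close> will be \<open>s * (a * s + 2 * b)\<close>. The
    sign of \<open>s\<close> makes the cross term negative, and the denominator keeps
    \<open>a * s\<close> smaller in absolute value than \<open>b\<close>, whatever the sign of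
    \<open>a\<close>.\<close>
  define s where "s = - b / (\<bar>a\<bar> + 1)"
  define F where "F = (\<lambda>\<alpha>. if \<alpha> = [i] then s else if \<alpha> = \<beta> then 1 else 0)"
  have ne: "[i] \<noteq> \<beta>" using w d w_eq by auto
  have sub: "{[i], \<beta>} \<subseteq> ?W" using w d w_eq by (auto simp: index_words_def)
  have red: "(\<Sum>\<alpha>\<in>?W. g \<alpha> * F \<alpha>) = g [i] * s + g \<beta>" for g :: "'g list \<Rightarrow> real"
  proof -
    have "(\<Sum>\<alpha>\<in>?W. g \<alpha> * F \<alpha>) = (\<Sum>\<alpha>\<in>{[i], \<beta>}. g \<alpha> * F \<alpha>)"
      using sub by (intro sum.mono_neutral_right) (auto simp: F_def)
    also have "\<dots> = g [i] * s + g \<beta>" using ne by (simp add: F_def)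
    finally show ?thesis .
  qed
  have "hankel_form p F = (\<Sum>\<alpha>\<in>?W. (\<Sum>\<beta>\<in>?W. Poly_Mapping.lookup p (rev \<alpha> @ \<beta>) * F \<beta>) * F \<alpha>)"
    unfolding hankel_form_def sum_distrib_right by (intro sum.cong refl) (simp add: mult_ac)
  also have "\<dots> = a * s * s + b * s + (Poly_Mapping.lookup p (rev \<beta> @ [i]) * s + Poly_Mapping.lookup p (rev \<beta> @ \<beta>))"
    by (simp only: red) (simp add: a_def b_def w_eq algebra_simps)
  also have "Poly_Mapping.lookup p (rev \<beta> @ [i]) = b"
    using lookup_symmetric[OF sym, of w] by (simp add: b_def w_eq)
  \<comment> \<open>This word has length 2(d - 1), which exceeds d exactly because d > 2.\<close>
  also have "Poly_Mapping.lookup p (rev \<beta> @ \<beta>) = 0"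
    using d w w_eq by (intro lookup_above_degree) auto
  finally have "hankel_form p F = s * (a * s + 2 * b)" by (simp add: algebra_simps)
  also have "\<dots> = - (b\<^sup>2 / (\<bar>a\<bar> + 1)\<^sup>2) * (2 * \<bar>a\<bar> - a + 2)"
    by (simp add: s_def field_simps power2_eq_square add_pos_nonneg add_nonneg_eq_0_iff)
  also have "\<dots> < 0"
  proof -
    have "b\<^sup>2 / (\<bar>a\<bar> + 1)\<^sup>2 > 0"
      using w by (intro divide_pos_pos) (auto simp: b_def add_nonneg_eq_0_iff)
    moreover have "2 * \<bar>a\<bar> - a + 2 > 0" by linarith
    ultimately show ?thesis by (metis mult_pos_pos mult_minus_left neg_less_0_iff_less)
  qed
  finally show False using nonneg[of F] by simp
qed

text \<open>This is the Hankel form restricted to functions supported on the words of length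
  one.\<close>

lemma quadratic_part_nonneg:
  fixes p :: "'g::finite ncpoly"
  assumes nonneg: "\<And>F. 0 \<le> hankel_form p F"
  shows "0 \<le> (\<Sum>(i, j)\<in>UNIV. Poly_Mapping.lookup p [i, j] * f i * f j)"
proof (cases "nc_degree p = 0")
  case True
  then have "Poly_Mapping.lookup p [i, j] = 0" for i j by (intro lookup_above_degree) auto
  then show ?thesis by (simp add: case_prod_beta)
next
  case False
  let ?W = "index_words (nc_degree p) :: 'g list set"
  define F where "F = (\<lambda>w. if length w = 1 then f (hd w) else 0)"
  have red: "(\<Sum>\<alpha>\<in>?W. g \<alpha> * F \<alpha>) = (\<Sum>i\<in>UNIV. g [i] * f i)" for g :: "'g list \<Rightarrow> real"
  proof -
    have "(\<Sum>\<alpha>\<in>?W. g \<alpha> * F \<alpha>) = (\<Sum>\<alpha>\<in>range (\<lambda>i. [i]). g \<alpha> * F \<alpha>)"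
      using False
      by (intro sum.mono_neutral_right) (auto simp: F_def index_words_def length_Suc_conv Suc_le_eq)
    also have "\<dots> = (\<Sum>i\<in>UNIV. g [i] * f i)"
      by (subst sum.reindex) (auto simp: F_def inj_on_def)
    finally show ?thesis .
  qed
  have "hankel_form p F = (\<Sum>\<alpha>\<in>?W. (\<Sum>\<beta>\<in>?W. Poly_Mapping.lookup p (rev \<alpha> @ \<beta>) * F \<beta>) * F \<alpha>)"
    unfolding hankel_form_def sum_distrib_right by (intro sum.cong refl) (simp add: mult_ac)
  also have "\<dots> = (\<Sum>i\<in>UNIV. \<Sum>j\<in>UNIV. Poly_Mapping.lookup p [i, j] * f i * f j)"
    by (simp only: red) (simp add: sum_distrib_left mult_ac)
  also have "\<dots> = (\<Sum>(i, j)\<in>UNIV. Poly_Mapping.lookup p [i, j] * f i * f j)"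
    by (simp add: sum.cartesian_product flip: UNIV_Times_UNIV)
  finally show ?thesis using nonneg[of F] by simp
qed

text \<open>Reversal permutes the support of \<open>p\<close>, preserves its coefficients and
  transposes the values of words.\<close>

lemma nc_eval_symmetric:
  assumes sym: "nc_symmetric p" and X: "X \<in> sym_tuples n"
  shows "transpose_mat (nc_eval n X p) = nc_eval n X p"
proof (rule eq_matI)
  fix i j assume "i < dim_row (nc_eval n X p)" "j < dim_col (nc_eval n X p)"
  then have ij: "i < n" "j < n" by (simp_all add: nc_eval_def)
  have W: "word_eval n X w \<in> carrier_mat n n" for w
    using X by (intro word_eval_carrier) (auto simp: sym_tuples_def)
  have "nc_eval n X p $$ (j, i) = (\<Sum>w\<in>Poly_Mapping.keys p. Poly_Mapping.lookup p w * word_eval n X w $$ (j, i))"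
    using ij by (intro nc_eval_index) auto
  also have "\<dots> = (\<Sum>w\<in>Poly_Mapping.keys p. Poly_Mapping.lookup p w * word_eval n X w $$ (i, j))"
    using ij carrier_matD[OF W]
    by (intro sum.reindex_bij_witness[of _ rev rev])
       (auto simp: in_keys_iff lookup_symmetric[OF sym] word_eval_rev[OF X])
  also have "\<dots> = nc_eval n X p $$ (i, j)"
    using ij by (intro nc_eval_index[symmetric]) auto
  finally show "transpose_mat (nc_eval n X p) $$ (i, j) = nc_eval n X p $$ (i, j)"
    using ij carrier_matD[OF nc_eval_carrier[of n X p]] by simp
qed (simp_all add: nc_eval_def)

section \<open>Convexity of quadratic polynomials\<close>

lemma smult_mat_mult_vec:
  fixes A :: "real mat"
  assumes "A \<in> carrier_mat n m" "v \<in> carrier_vec m"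
  shows "(c \<cdot>\<^sub>m A) *\<^sub>v v = c \<cdot>\<^sub>v (A *\<^sub>v v)"
  using assms by (intro eq_vecI) (auto simp: scalar_prod_def sum_distrib_left mult.assoc)

lemma sym_tuples_convex_combination:
  assumes X: "X \<in> sym_tuples n" and Y: "Y \<in> sym_tuples n"
  shows "(\<lambda>j. s \<cdot>\<^sub>m X j + t \<cdot>\<^sub>m Y j) \<in> sym_tuples n"
proof -
  have "transpose_mat (c \<cdot>\<^sub>m A) = c \<cdot>\<^sub>m transpose_mat A" for c and A :: "real mat"
    by (rule eq_matI) auto
  with X Y show ?thesis by (simp add: sym_tuples_def transpose_add[of _ n n])
qed

text \<open>Polarized form of the scalar identity
  \<open>t x^2 + (1-t) y^2 - (t x + (1-t) y)^2 = t (1-t) (x-y)^2\<close>, summed over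
  coordinates.\<close>

lemma quadratic_convexity_identity_vec:
  fixes x x' y y' :: "real vec"
  assumes "x \<in> carrier_vec n" "x' \<in> carrier_vec n" "y \<in> carrier_vec n" "y' \<in> carrier_vec n"
  shows "t * (x \<bullet> x') + (1 - t) * (y \<bullet> y')
      - (t \<cdot>\<^sub>v x + (1 - t) \<cdot>\<^sub>v y) \<bullet> (t \<cdot>\<^sub>v x' + (1 - t) \<cdot>\<^sub>v y')
    = t * (1 - t) * (\<Sum>k<n. (x - y) $ k * (x' - y') $ k)"
proof -
  have "t * (x \<bullet> x') + (1 - t) * (y \<bullet> y')
      - (t \<cdot>\<^sub>v x + (1 - t) \<cdot>\<^sub>v y) \<bullet> (t \<cdot>\<^sub>v x' + (1 - t) \<cdot>\<^sub>v y')
    = (\<Sum>k<n. t * (x $ k * x' $ k) + (1 - t) * (y $ k * y' $ k)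
      - (t * x $ k + (1 - t) * y $ k) * (t * x' $ k + (1 - t) * y' $ k))"
    using assms
    by (simp add: scalar_prod_def sum_distrib_left atLeast0LessThan sum.distrib sum_subtractf)
  also have "\<dots> = (\<Sum>k<n. t * (1 - t) * ((x - y) $ k * (x' - y') $ k))"
    using assms by (intro sum.cong refl) (simp add: algebra_simps)
  finally show ?thesis by (simp add: sum_distrib_left)
qed

text \<open>Words of length at most one are affine in the tuple and have no convexity defect. For a
  word of length two, symmetry moves the first letter to the other side of the inner product, and
  the vector identity applies.\<close>

lemma quadratic_convexity_identity:
  assumes X: "X \<in> sym_tuples n" and Y: "Y \<in> sym_tuples n" and v: "v \<in> carrier_vec n"
    and w: "length w \<le> 2"
  shows "t * ((word_eval n X w *\<^sub>v v) \<bullet> v) + (1 - t) * ((word_eval n Y w *\<^sub>v v) \<bullet> v)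
      - (word_eval n (\<lambda>j. t \<cdot>\<^sub>m X j + (1 - t) \<cdot>\<^sub>m Y j) w *\<^sub>v v) \<bullet> v
    = (case w of [i, j] \<Rightarrow> t * (1 - t) * (\<Sum>k<n. (X i *\<^sub>v v - Y i *\<^sub>v v) $ k * (X j *\<^sub>v v - Y j *\<^sub>v v) $ k)
       | _ \<Rightarrow> 0)"
proof -
  let ?Z = "\<lambda>j. t \<cdot>\<^sub>m X j + (1 - t) \<cdot>\<^sub>m Y j"
  have Z: "?Z \<in> sym_tuples n"
    by (rule sym_tuples_convex_combination[OF X Y])
  have one: "word_eval n U [i] *\<^sub>v v = U i *\<^sub>v v" and two: "(word_eval n U [i, j] *\<^sub>v v) \<bullet> v = (U i *\<^sub>v v) \<bullet> (U j *\<^sub>v v)"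
    if "U \<in> sym_tuples n" for U :: "'a \<Rightarrow> real mat" and i j
  proof -
    have U: "U i \<in> carrier_mat n n" for i using that by (auto simp: sym_tuples_def)
    show one: "word_eval n U [i] *\<^sub>v v = U i *\<^sub>v v" for i
      using right_mult_one_mat[OF U] by simp
    have "(word_eval n U [i, j] *\<^sub>v v) \<bullet> v = (word_eval n U [i] *\<^sub>v (U j *\<^sub>v v)) \<bullet> v"
      using right_mult_one_mat[OF U] v by (simp add: assoc_mult_mat_vec[OF U U])
    also have "\<dots> = (U j *\<^sub>v v) \<bullet> (word_eval n U [i] *\<^sub>v v)"
      using word_eval_adjoint[OF that, of "U j *\<^sub>v v" v "[i]"] U[of j] v by simp
    also have "\<dots> = (U i *\<^sub>v v) \<bullet> (U j *\<^sub>v v)"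
      using U[of i] U[of j] v one by (metis comm_scalar_prod mult_mat_vec_carrier)
    finally show "(word_eval n U [i, j] *\<^sub>v v) \<bullet> v = (U i *\<^sub>v v) \<bullet> (U j *\<^sub>v v)" .
  qed
  have Zv: "?Z i *\<^sub>v v = t \<cdot>\<^sub>v (X i *\<^sub>v v) + (1 - t) \<cdot>\<^sub>v (Y i *\<^sub>v v)" for i
    using X Y v by (simp add: sym_tuples_def add_mult_distrib_mat_vec[of _ n n] smult_mat_mult_vec[of _ n n])
  have c: "X i *\<^sub>v v \<in> carrier_vec n" "Y i *\<^sub>v v \<in> carrier_vec n" for i
    using X Y v by (auto simp: sym_tuples_def intro!: mult_mat_vec_carrier[of _ n n])
  \<comment> \<open>The case rule of \<open>remdups_adj\<close> is borrowed because it separates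
    lists with no, one, and at least two elements.\<close>
  consider "w = []" | i where "w = [i]" | i j where "w = [i, j]"
    using w by (cases w rule: remdups_adj.cases) auto
  then show ?thesis
  proof cases
    case 1
    then show ?thesis by (simp add: algebra_simps)
  next
    case 2
    then show ?thesis
      using c v by (simp add: one X Y Z one[OF Z] Zv del: word_eval_Cons) 
       (simp add: add_scalar_prod_distrib[of _ n] smult_scalar_prod_distrib[of _ n])
  next
    case (3 i j)
    have "t * ((X i *\<^sub>v v) \<bullet> (X j *\<^sub>v v)) + (1 - t) * ((Y i *\<^sub>v v) \<bullet> (Y j *\<^sub>v v))
        - (t \<cdot>\<^sub>v (X i *\<^sub>v v) + (1 - t) \<cdot>\<^sub>v (Y i *\<^sub>v v)) \<bullet> (t \<cdot>\<^sub>v (X j *\<^sub>v v) + (1 - t) \<cdot>\<^sub>v (Y j *\<^sub>v v))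
      = t * (1 - t) * (\<Sum>k<n. (X i *\<^sub>v v - Y i *\<^sub>v v) $ k * (X j *\<^sub>v v - Y j *\<^sub>v v) $ k)"
      by (rule quadratic_convexity_identity_vec) (rule c)+
    with 3 show ?thesis
      using two[OF X, of i j] two[OF Y, of i j] two[OF Z, of i j] by (simp add: Zv del: word_eval_Cons)
  qed
qed

text \<open>Tested on v, the convexity defect is t(1 - t) times a sum over the coordinates k of the
  quadratic part, evaluated at the numbers \<open>f i\<close> given by the k-th coordinate of
  \<open>X i *\<^sub>v v - Y i *\<^sub>v v\<close>.\<close>

lemma convex_if_quadratic_part_nonneg:
  fixes p :: "'g::finite ncpoly"
  assumes sym: "nc_symmetric p" and deg: "nc_degree p \<le> 2"
    and nonneg: "\<And>f. 0 \<le> (\<Sum>(i, j)\<in>UNIV. Poly_Mapping.lookup p [i, j] * f i * f j)"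
  shows "nc_convex p"
  unfolding nc_convex_def
proof (intro allI impI ballI)
  fix n :: nat and X Y :: "'g \<Rightarrow> real mat" and t :: real
  assume X: "X \<in> sym_tuples n" and Y: "Y \<in> sym_tuples n" and t: "0 \<le> t \<and> t \<le> 1"
  let ?Z = "\<lambda>j. t \<cdot>\<^sub>m X j + (1 - t) \<cdot>\<^sub>m Y j"
  have Z: "?Z \<in> sym_tuples n"
    by (rule sym_tuples_convex_combination[OF X Y])
  let ?M = "t \<cdot>\<^sub>m nc_eval n X p + (1 - t) \<cdot>\<^sub>m nc_eval n Y p - nc_eval n ?Z p"
  have symM: "transpose_mat ?M = ?M"
  proof (rule eq_matI)
    fix i j assume "i < dim_row ?M" "j < dim_col ?M"
    then have ij: "i < n" "j < n" using carrier_matD[OF nc_eval_carrier[of n ?Z p]] by simp_all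
    have "nc_eval n U p $$ (j, i) = nc_eval n U p $$ (i, j)" if "U \<in> sym_tuples n" for U
      using nc_eval_symmetric[OF sym that] ij carrier_matD[OF nc_eval_carrier[of n U p]]
      by (metis index_transpose_mat(1))
    then show "transpose_mat ?M $$ (i, j) = ?M $$ (i, j)"
      using X Y Z ij carrier_matD[OF nc_eval_carrier[of n _ p]] by simp
  qed (use carrier_matD[OF nc_eval_carrier[of n _ p]] in simp_all)
  have "0 \<le> (?M *\<^sub>v v) \<bullet> v" if v: "v \<in> carrier_vec n" for v
  proof -
    let ?S = "{w :: 'g list. length w \<le> 2}"
    let ?p = "Poly_Mapping.lookup p"
    let ?D = "\<lambda>i. X i *\<^sub>v v - Y i *\<^sub>v v"
    let ?q = "\<lambda>w. case w of [i, j] \<Rightarrow> t * (1 - t) * (\<Sum>k<n. ?D i $ k * ?D j $ k) | _ \<Rightarrow> 0"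
    have keys: "Poly_Mapping.keys p \<subseteq> ?S"
    proof
      fix w assume "w \<in> Poly_Mapping.keys p"
      then show "w \<in> ?S" using deg lookup_above_degree[of p w] by (force simp: in_keys_iff)
    qed
    have ev: "(nc_eval n U p *\<^sub>v v) \<bullet> v = (\<Sum>w\<in>?S. ?p w * ((word_eval n U w *\<^sub>v v) \<bullet> v))"
      if "U \<in> sym_tuples n" for U
      using that v keys by (intro nc_eval_scalar_prod) (auto simp: sym_tuples_def)
    have "(?M *\<^sub>v v) \<bullet> v = t * ((nc_eval n X p *\<^sub>v v) \<bullet> v) + (1 - t) * ((nc_eval n Y p *\<^sub>v v) \<bullet> v)
        - (nc_eval n ?Z p *\<^sub>v v) \<bullet> v"
      using v by (simp add: minus_mult_distrib_mat_vec[of _ n n] add_mult_distrib_mat_vec[of _ n n]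
          smult_mat_mult_vec[of _ n n] smult_scalar_prod_distrib[of _ n] mult_mat_vec_carrier[of _ n n] minus_scalar_prod_distrib[of _ n] add_scalar_prod_distrib[of _ n])
    also have "\<dots> = (\<Sum>w\<in>?S. ?p w * (t * ((word_eval n X w *\<^sub>v v) \<bullet> v)
        + (1 - t) * ((word_eval n Y w *\<^sub>v v) \<bullet> v) - (word_eval n ?Z w *\<^sub>v v) \<bullet> v))"
      by (simp only: ev[OF X] ev[OF Y] ev[OF Z] sum_distrib_left sum.distrib[symmetric] sum_subtractf[symmetric])
         (simp add: algebra_simps)
    also have "\<dots> = (\<Sum>w\<in>?S. ?p w * ?q w)"
      by (intro sum.cong refl) (simp only: quadratic_convexity_identity[OF X Y v] mem_Collect_eq)
    also have "\<dots> = (\<Sum>w\<in>range (\<lambda>(i, j). [i, j]). ?p w * ?q w)"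
      by (intro sum.mono_neutral_right) (auto split: list.splits)
    also have "\<dots> = (\<Sum>(i, j)\<in>UNIV. ?p [i, j] * ?q [i, j])"
      by (subst sum.reindex) (auto simp: inj_on_def case_prod_beta)
    also have "\<dots> = (\<Sum>ij\<in>UNIV. \<Sum>k<n. t * (1 - t) * (?p [fst ij, snd ij] * ?D (fst ij) $ k * ?D (snd ij) $ k))"
      by (simp add: case_prod_beta sum_distrib_left mult_ac)
    also have "\<dots> = (\<Sum>k<n. \<Sum>ij\<in>UNIV. t * (1 - t) * (?p [fst ij, snd ij] * ?D (fst ij) $ k * ?D (snd ij) $ k))"
      by (rule sum.swap)
    also have "\<dots> = (\<Sum>k<n. t * (1 - t) * (\<Sum>(i, j)\<in>UNIV. ?p [i, j] * ?D i $ k * ?D j $ k))"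
      by (simp add: sum_distrib_left case_prod_beta)
    also have "\<dots> \<ge> 0"
      using t by (intro sum_nonneg mult_nonneg_nonneg nonneg) auto
    finally show ?thesis .
  qed
  with symM show "psd n ?M" by (auto simp: psd_def minus_carrier_mat)
qed

section \<open>The truncated Fock space\<close>

text \<open>The matrix \<open>c\<close> is unitriangular with respect to word length, hence the
  system can be solved length by length.\<close>

lemma triangular_dual_functional:
  fixes c :: "'g::finite list \<Rightarrow> 'g list \<Rightarrow> real"
  assumes c: "\<And>m u. length m \<le> length u \<Longrightarrow> length u < d \<Longrightarrow> c m u = (if u = m then 1 else 0)"
  shows "\<exists>g. \<forall>m. length m < d \<longrightarrow> (\<Sum>u | length u < d. g u * c m u) = f m"
proof -
  have "\<exists>g. \<forall>m. length m < k \<longrightarrow> (\<Sum>u | length u < k. g u * c m u) = f m" if "k \<le> d" for k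
    using that
  proof (induction k)
    case (Suc k)
    then obtain g where g: "\<And>m. length m < k \<Longrightarrow> (\<Sum>u | length u < k. g u * c m u) = f m" by auto
    \<comment> \<open>The residual left by the solution on shorter words. At words of length k the
      matrix is the identity against words of length k and zero against shorter ones, so adding
      \<open>r\<close> there solves the new equations and keeps the old ones.\<close>
    define r where "r = (\<lambda>m. f m - (\<Sum>u | length u < k. g u * c m u))"
    define g' where "g' = (\<lambda>u. if length u = k then r u else g u)"
    have "(\<Sum>u | length u < Suc k. g' u * c m u) = f m" if m: "length m < Suc k" for m
    proof -
      have split: "{u :: 'g list. length u < Suc k} = {u. length u < k} \<union> {u. length u = k}" by auto
      have fin: "finite {u :: 'g list. length u = k}"
        by (rule finite_subset[OF _ finite_words_le[of k]]) auto
      have "(\<Sum>u | length u < Suc k. g' u * c m u)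
          = (\<Sum>u | length u < k. g' u * c m u) + (\<Sum>u | length u = k. g' u * c m u)"
        unfolding split by (intro sum.union_disjoint fin) auto
      also have "(\<Sum>u | length u < k. g' u * c m u) = (\<Sum>u | length u < k. g u * c m u)"
        by (intro sum.cong) (auto simp: g'_def)
      also have "(\<Sum>u | length u = k. g' u * c m u) = (\<Sum>u | length u = k. if u = m then r m else 0)"
        using m Suc.prems by (intro sum.cong) (auto simp: g'_def c)
      also have "\<dots> = (if length m = k then r m else 0)" using fin by simp
      finally show ?thesis using m g[of m] by (auto simp: r_def less_Suc_eq)
    qed
    then show ?case by blast
  qed simp
  then show ?thesis by blast
qed

text \<open>The tuple is the sum of the creation and annihilation operators on the words of length
  less than \<open>d\<close> (a truncated Fock space), extended by zero to one further coordinate \<open>k\<close>.\<close>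

lemma fock_space_tuple:
  fixes d :: nat
  obtains n :: nat and X :: "'g::finite \<Rightarrow> real mat" and v k :: "real vec"
  where "n \<ge> 1" "X \<in> sym_tuples n" "v \<in> carrier_vec n" "k \<in> carrier_vec n"
    "k \<bullet> k = 1" "v \<bullet> k = 0" "\<And>j. X j *\<^sub>v k = 0\<^sub>v n"
    "\<And>f :: 'g list \<Rightarrow> real. \<exists>\<phi>\<in>carrier_vec n. \<phi> \<bullet> k = 0 \<and>
      (\<forall>m. length m < d \<longrightarrow> \<phi> \<bullet> (word_eval n X m *\<^sub>v v) = f m)"
proof -
  let ?L = "{u :: 'g list. length u < d}"
  \<comment> \<open>\<open>Some u\<close> labels the basis vector of the word u, and
    \<open>None\<close> the additional coordinate.\<close>
  define B :: "'g list option set" where "B = insert None (Some ` ?L)"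
  have finB: "finite B" by (simp add: B_def)
  have sumB: "(\<Sum>b\<in>B. h b) = h None + (\<Sum>u\<in>?L. h (Some u))" for h :: "'g list option \<Rightarrow> real"
    by (simp add: B_def sum.reindex image_iff)
  define n where "n = card B"
  obtain e where e: "bij_betw e {0..<n} B"
    using ex_bij_betw_nat_finite[OF finB] by (auto simp: n_def)
  define V where "V = (\<lambda>h :: 'g list option \<Rightarrow> real. vec n (\<lambda>a. h (e a)))"
  have V_carrier: "V h \<in> carrier_vec n" for h by (simp add: V_def)
  have V_prod: "V g \<bullet> V h = (\<Sum>b\<in>B. g b * h b)" for g h
    using sum.reindex_bij_betw[OF e, of "\<lambda>b. g b * h b"] by (simp add: V_def scalar_prod_def)
  define ad :: "'g \<Rightarrow> 'g list option \<Rightarrow> 'g list option \<Rightarrow> real" where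
    "ad = (\<lambda>j x y. case (x, y) of (Some u, Some w) \<Rightarrow> (if u = j # w \<or> w = j # u then 1 else 0) | _ \<Rightarrow> 0)"
  have ad_sym: "ad j x y = ad j y x" for j x y
    by (auto simp: ad_def split: option.splits)
  have ad_None: "ad j None y = 0" "ad j x None = 0" for j x y
    by (auto simp: ad_def split: option.splits)
  define X where "X = (\<lambda>j. mat n n (\<lambda>(a, b). ad j (e a) (e b)))"
  have X: "X \<in> sym_tuples n"
    by (auto simp: sym_tuples_def X_def intro!: eq_matI ad_sym)
  have Xc: "X j \<in> carrier_mat n n" for j by (simp add: X_def)
  have XV: "X j *\<^sub>v V h = V (\<lambda>x. \<Sum>y\<in>B. ad j x y * h y)" for j h
    using sum.reindex_bij_betw[OF e, of "\<lambda>y. ad j x y * h y" for x]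
    by (intro eq_vecI) (simp_all add: X_def V_def scalar_prod_def)
  define k where "k = V (\<lambda>b. if b = None then 1 else 0)"
  \<comment> \<open>The vacuum is the basis vector of the empty word. For d = 0 that label is not in
    \<open>B\<close> and \<open>V \<Omega>\<close> is zero, but then no word has to be paired with
    it.\<close>
  define \<Omega> :: "'g list option \<Rightarrow> real" where "\<Omega> = (\<lambda>b. if b = Some [] then 1 else 0)"
  define c where "c = (\<lambda>m. foldr (\<lambda>j h x. \<Sum>y\<in>B. ad j x y * h y) m \<Omega>)"
  have c_Nil: "c [] = \<Omega>" and c_Cons: "c (j # m) = (\<lambda>x. \<Sum>y\<in>B. ad j x y * c m y)" for j m
    by (simp_all add: c_def)
  have word: "word_eval n X m *\<^sub>v V \<Omega> = V (c m)" for m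
  proof (induction m)
    case Nil
    then show ?case using V_carrier by (simp add: c_Nil)
  next
    case (Cons j m)
    then show ?case
      using assoc_mult_mat_vec[OF Xc word_eval_carrier[of X, OF Xc] V_carrier] by (simp add: XV c_Cons)
  qed
  \<comment> \<open>Each letter lengthens a word by at most one, and only by prepending itself; so
    the word m applied to the vacuum gives the basis vector of m plus shorter words.\<close>
  have triangular: "c m (Some u) = (if u = m then 1 else 0)" if "length m \<le> length u" "length u < d" for m u
    using that
  proof (induction m arbitrary: u)
    case Nil
    then show ?case by (simp add: c_Nil \<Omega>_def)
  next
    case (Cons j m)
    have "c (j # m) (Some u) = (\<Sum>w\<in>?L. ad j (Some u) (Some w) * c m (Some w))"
      by (simp add: c_Cons sumB ad_None)
    also have "\<dots> = (\<Sum>w\<in>?L. if w = m then (if u = j # m then 1 else 0) else 0)"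
    proof (intro sum.cong refl)
      fix w assume "w \<in> ?L"
      \<comment> \<open>If w is shorter than m, then u is longer than w by at least two letters and
        the entry of \<open>ad\<close> is zero; otherwise the induction hypothesis gives
        \<open>c m (Some w)\<close>.\<close>
      then show "ad j (Some u) (Some w) * c m (Some w) = (if w = m then (if u = j # m then 1 else 0) else 0)"
        using Cons.prems Cons.IH[of w] by (cases "length m \<le> length w") (auto simp: ad_def)
    qed
    also have "\<dots> = (if u = j # m then 1 else 0)"
      using Cons.prems by simp
    finally show ?case .
  qed
  have k0: "V h \<bullet> k = h None" for h
    by (simp add: k_def V_prod sumB)
  have dual: "\<exists>\<phi>\<in>carrier_vec n. \<phi> \<bullet> k = 0 \<and>
      (\<forall>m. length m < d \<longrightarrow> \<phi> \<bullet> (word_eval n X m *\<^sub>v V \<Omega>) = f m)" for f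
  proof -
    obtain g where g: "\<And>m. length m < d \<Longrightarrow> (\<Sum>u\<in>?L. g u * c m (Some u)) = f m"
      using triangular_dual_functional[of d "\<lambda>m u. c m (Some u)" f] triangular by auto
    let ?\<phi> = "V (case_option 0 g)"
    have "?\<phi> \<bullet> k = 0" by (simp add: k0)
    moreover have "?\<phi> \<bullet> (word_eval n X m *\<^sub>v V \<Omega>) = f m" if "length m < d" for m
      using g[OF that] by (simp add: word V_prod sumB)
    ultimately show ?thesis using V_carrier by blast
  qed
  show ?thesis
  proof (rule that[OF _ X V_carrier _ _ _ _ dual])
    show "n \<ge> 1" using finB by (simp add: n_def B_def Suc_le_eq card_gt_0_iff)
    show "k \<in> carrier_vec n" by (simp add: k_def V_carrier)
    show "k \<bullet> k = 1" using k0[of "\<lambda>b. if b = None then 1 else 0"] by (simp add: k_def)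
    show "V \<Omega> \<bullet> k = 0" by (simp add: k0 \<Omega>_def)
    show "X j *\<^sub>v k = 0\<^sub>v n" for j
      unfolding k_def XV by (rule eq_vecI) (simp_all add: V_def sumB ad_None)
  qed
qed

lemma word_eval_smult:
  assumes X: "\<And>j. X j \<in> carrier_mat n n"
  shows "word_eval n (\<lambda>j. t \<cdot>\<^sub>m X j) w = t ^ length w \<cdot>\<^sub>m word_eval n X w"
proof (induction w)
  case Nil
  then show ?case by (intro eq_matI) auto
next
  case (Cons j w)
  then show ?case
    using word_eval_carrier[of X n w, OF X] X[of j]
    by (simp add: mult_smult_assoc_mat[of _ n n _ n] mult_smult_distrib[of _ n n _ n] smult_smult_mat mult.commute)
qed

text \<open>Scaling the tuple by t > 0 multiplies the value of a word m by
  \<open>t ^ length m\<close>, which is absorbed into the prescribed values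
  \<open>f m\<close>.\<close>

lemma small_fock_space_tuple:
  fixes N :: "nat \<Rightarrow> ('g::finite \<Rightarrow> real mat) \<Rightarrow> real"
  assumes norms: "\<And>n. n \<ge> 1 \<Longrightarrow> norm_on_sym_tuples n (N n)" and \<epsilon>: "\<epsilon> > 0"
  obtains n :: nat and X :: "'g \<Rightarrow> real mat" and v k :: "real vec"
  where "n \<ge> 1" "X \<in> sym_tuples n" "N n X < \<epsilon>" "v \<in> carrier_vec n" "k \<in> carrier_vec n"
    "k \<bullet> k = 1" "v \<bullet> k = 0" "\<And>j. X j *\<^sub>v k = 0\<^sub>v n"
    "\<And>f :: 'g list \<Rightarrow> real. \<exists>\<phi>\<in>carrier_vec n. \<phi> \<bullet> k = 0 \<and>
      (\<forall>m. length m < d \<longrightarrow> \<phi> \<bullet> (word_eval n X m *\<^sub>v v) = f m)"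
proof -
  obtain n and X :: "'g \<Rightarrow> real mat" and v k where n: "n \<ge> 1" and X: "X \<in> sym_tuples n"
    and vk: "v \<in> carrier_vec n" "k \<in> carrier_vec n" "k \<bullet> k = 1" "v \<bullet> k = 0"
    and Xk: "\<And>j. X j *\<^sub>v k = 0\<^sub>v n"
    and dual: "\<And>f :: 'g list \<Rightarrow> real. \<exists>\<phi>\<in>carrier_vec n. \<phi> \<bullet> k = 0 \<and>
      (\<forall>m. length m < d \<longrightarrow> \<phi> \<bullet> (word_eval n X m *\<^sub>v v) = f m)"
    by (rule fock_space_tuple[of d]) blast
  have Xc: "X j \<in> carrier_mat n n" for j using X by (simp add: sym_tuples_def)
  have N0: "0 \<le> N n X" using norms[OF n] X by (auto simp: norm_on_sym_tuples_def)
  \<comment> \<open>The summand 1 keeps the denominator positive and makes the scaled norm strictly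
    less than \<epsilon>.\<close>
  define t where "t = \<epsilon> / (N n X + 1)"
  have t: "t > 0" using N0 \<epsilon> by (simp add: t_def)
  let ?X = "\<lambda>j. t \<cdot>\<^sub>m X j"
  have smallX: "N n ?X < \<epsilon>"
  proof -
    have "N n ?X = t * N n X" using norms[OF n] X t by (simp add: norm_on_sym_tuples_def)
    also have "\<dots> < \<epsilon>" using N0 \<epsilon> by (simp add: t_def field_simps)
    finally show ?thesis .
  qed
  have symX: "?X \<in> sym_tuples n"
  proof -
    have "transpose_mat (t \<cdot>\<^sub>m A) = t \<cdot>\<^sub>m transpose_mat A" for A :: "real mat" by (rule eq_matI) auto
    with X show ?thesis by (simp add: sym_tuples_def)
  qed
  have "\<exists>\<phi>\<in>carrier_vec n. \<phi> \<bullet> k = 0 \<and>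
      (\<forall>m. length m < d \<longrightarrow> \<phi> \<bullet> (word_eval n ?X m *\<^sub>v v) = f m)" for f
  proof -
    obtain \<phi> where \<phi>: "\<phi> \<in> carrier_vec n" "\<phi> \<bullet> k = 0"
      "\<And>m. length m < d \<Longrightarrow> \<phi> \<bullet> (word_eval n X m *\<^sub>v v) = f m / t ^ length m"
      using dual[of "\<lambda>m. f m / t ^ length m"] by blast
    have "\<phi> \<bullet> (word_eval n ?X m *\<^sub>v v) = f m" if "length m < d" for m
      using \<phi>(1) \<phi>(3)[OF that] t vk word_eval_carrier[of X n m, OF Xc]
      by (simp add: word_eval_smult[of X, OF Xc] smult_mat_mult_vec[of _ n n] scalar_prod_smult_distrib[of _ n])
    with \<phi> show ?thesis by blast
  qed
  moreover have "?X j *\<^sub>v k = 0\<^sub>v n" for j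
    using vk Xk by (simp add: smult_mat_mult_vec[OF Xc]) (auto intro!: eq_vecI)
  ultimately show ?thesis
    by (intro that[OF n symX smallX vk]) auto
qed

section \<open>Derivatives in a rank-two direction\<close>

lemma hcount_0: "hcount w = 0 \<Longrightarrow> \<exists>m. w = map Inl m"
proof (induction w)
  case (Cons x w)
  then show ?case
    by (cases x) (auto simp: Cons_eq_map_conv)
qed simp

lemma hcount_Suc: "hcount w = Suc k \<Longrightarrow> \<exists>m j w'. w = map Inl m @ Inr j # w' \<and> hcount w' = k"
proof (induction w)
  case (Cons x w)
  show ?case
  proof (cases x)
    case (Inl i)
    then obtain m j w' where "w = map Inl m @ Inr j # w'" "hcount w' = k" using Cons by auto
    with Inl show ?thesis by (intro exI[of _ "i # m"]) auto
  next
    case (Inr j)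
    with Cons show ?thesis by (intro exI[of _ "[]"]) auto
  qed
qed simp

lemma map_Inl_append_inject:
  "map Inl a @ Inr i # u = map Inl b @ Inr j # w \<longleftrightarrow> a = b \<and> i = j \<and> u = w"
proof (induction a arbitrary: b)
  case Nil
  then show ?case by (cases b) auto
next
  case (Cons x a)
  then show ?case by (cases b) auto
qed

lemma mult_mat_zero_vec: "A \<in> carrier_mat m n \<Longrightarrow> A *\<^sub>v 0\<^sub>v n = 0\<^sub>v m"
  for A :: "'a::semiring_0 mat"
  by (intro eq_vecI) auto

text \<open>The assumptions are arranged so that, for |m| < d, the direction \<open>H j\<close> maps
  the vector of the word m exactly to \<open>F (j # m) \<cdot>\<^sub>v k\<close>.\<close>

locale rank_two_direction =
  fixes n d :: nat and X :: "'g::finite \<Rightarrow> real mat" and v k :: "real vec"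
    and F :: "'g list \<Rightarrow> real" and \<phi> :: "'g \<Rightarrow> real vec"
  assumes X: "X \<in> sym_tuples n" and v: "v \<in> carrier_vec n" and k: "k \<in> carrier_vec n"
    and kk: "k \<bullet> k = 1" and vk: "v \<bullet> k = 0" and Xk: "\<And>j. X j *\<^sub>v k = 0\<^sub>v n"
    and \<phi>: "\<And>j. \<phi> j \<in> carrier_vec n" and \<phi>k: "\<And>j. \<phi> j \<bullet> k = 0"
    and dual: "\<And>j m. length m < d \<Longrightarrow> \<phi> j \<bullet> (word_eval n X m *\<^sub>v v) = F (j # m)"
begin

definition H :: "'g \<Rightarrow> real mat" where
  "H j = mat n n (\<lambda>(a, b). k $ a * \<phi> j $ b + \<phi> j $ a * k $ b)"

abbreviation Y :: "'g + 'g \<Rightarrow> real mat" where "Y \<equiv> case_sum X H"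

lemma H: "H \<in> sym_tuples n"
  by (auto simp: sym_tuples_def H_def intro!: eq_matI)

lemma Xc: "X j \<in> carrier_mat n n" using X by (simp add: sym_tuples_def)

lemma Hc: "H j \<in> carrier_mat n n" by (simp add: H_def)

lemma Yc: "Y x \<in> carrier_mat n n"
  by (cases x) (simp_all add: Xc Hc)

lemma H_mult: "u \<in> carrier_vec n \<Longrightarrow> H j *\<^sub>v u = (\<phi> j \<bullet> u) \<cdot>\<^sub>v k + (k \<bullet> u) \<cdot>\<^sub>v \<phi> j"
  using k \<phi>[of j]
  by (intro eq_vecI)
     (auto simp: H_def scalar_prod_def sum.distrib sum_distrib_left sum_distrib_right algebra_simps)

lemma WX: "word_eval n X m \<in> carrier_mat n n"
  by (rule word_eval_carrier) (rule Xc)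

lemma WY: "word_eval n Y w \<in> carrier_mat n n"
  by (rule word_eval_carrier) (rule Yc)

lemma word_eval_Inl: "word_eval n Y (map Inl m) = word_eval n X m"
  by (induction m) auto

text \<open>The last letter of a word acts first, and it annihilates \<open>k\<close>; hence the
  case split at the end of \<open>m\<close>.\<close>

lemma word_X_k: "word_eval n X m *\<^sub>v k = (if m = [] then k else 0\<^sub>v n)"
proof (cases m rule: rev_cases)
  case Nil
  then show ?thesis using k by simp
next
  case (snoc m' j)
  have "word_eval n X m *\<^sub>v k = word_eval n X m' *\<^sub>v (word_eval n X [j] *\<^sub>v k)"
    using snoc k by (simp add: word_eval_append[of X, OF Xc] assoc_mult_mat_vec[OF WX WX] del: word_eval_Cons)
  also have "word_eval n X [j] *\<^sub>v k = 0\<^sub>v n"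
    using right_mult_one_mat[OF Xc] by (simp add: Xk)
  also have "word_eval n X m' *\<^sub>v 0\<^sub>v n = 0\<^sub>v n"
    using WX by (rule mult_mat_zero_vec)
  finally show ?thesis using snoc by simp
qed

lemma k_word: "k \<bullet> (word_eval n X m *\<^sub>v v) = 0"
proof -
  have "k \<bullet> (word_eval n X m *\<^sub>v v) = (word_eval n X (rev m) *\<^sub>v k) \<bullet> v"
    using word_eval_adjoint[OF X k v, of "rev m"] by simp
  also have "\<dots> = 0"
    using vk comm_scalar_prod[OF v k] v by (simp add: word_X_k)
  finally show ?thesis .
qed

text \<open>The direction letter produces a multiple of \<open>k\<close>, which any further letter
  in x annihilates. Only words that begin with the direction letter survive.\<close>

lemma word_one_h:
  assumes "length c < d"
  shows "word_eval n Y (map Inl a @ Inr j # map Inl c) *\<^sub>v v = (if a = [] then F (j # c) \<cdot>\<^sub>v k else 0\<^sub>v n)"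
proof -
  have wv: "word_eval n X c *\<^sub>v v \<in> carrier_vec n" using WX v by (rule mult_mat_vec_carrier)
  have "word_eval n Y (map Inl a @ Inr j # map Inl c) *\<^sub>v v
      = word_eval n X a *\<^sub>v (H j *\<^sub>v (word_eval n X c *\<^sub>v v))"
    by (simp only: word_eval_append[of Y, OF Yc, of "map Inl a"] word_eval_Inl word_eval_Cons sum.case
        assoc_mult_mat_vec[OF WX mult_carrier_mat[OF Hc WX] v] assoc_mult_mat_vec[OF Hc WX v])
  also have "H j *\<^sub>v (word_eval n X c *\<^sub>v v) = F (j # c) \<cdot>\<^sub>v k"
    using k \<phi>[of j] by (intro eq_vecI) (simp_all add: H_mult[OF wv] dual[OF assms] k_word)
  also have "word_eval n X a *\<^sub>v (F (j # c) \<cdot>\<^sub>v k) = F (j # c) \<cdot>\<^sub>v (word_eval n X a *\<^sub>v k)"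
    using mult_mat_vec[OF WX k] .
  finally show ?thesis by (auto simp: word_X_k)
qed

text \<open>The right direction letter lands on \<open>k\<close>, and a letter in x between the two
  would annihilate it. The left one sends the unit vector \<open>k\<close> to
  \<open>\<phi> i\<close>, and moving \<open>rev a\<close> across the inner product turns it into
  \<open>a\<close> acting on \<open>v\<close>.\<close>

lemma word_two_h:
  assumes "length c < d" "length a < d"
  shows "(word_eval n Y (map Inl (rev a) @ Inr i # map Inl b @ Inr j # map Inl c) *\<^sub>v v) \<bullet> v
    = (if b = [] then F (i # a) * F (j # c) else 0)"
proof -
  let ?u = "if b = [] then F (j # c) \<cdot>\<^sub>v k else 0\<^sub>v n"
  have u: "?u \<in> carrier_vec n" using k by simp
  have "word_eval n Y (map Inl (rev a) @ Inr i # map Inl b @ Inr j # map Inl c) *\<^sub>v v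
      = word_eval n X (rev a) *\<^sub>v (H i *\<^sub>v (word_eval n Y (map Inl b @ Inr j # map Inl c) *\<^sub>v v))"
    using v WY Hc
    by (simp only: word_eval_append[of Y, OF Yc, of "map Inl (rev a)"] word_eval_Inl word_eval_Cons
        assoc_mult_mat_vec[OF WX mult_carrier_mat[OF Hc WY] v] sum.case assoc_mult_mat_vec[OF Hc WY v])
  also have "\<dots> = word_eval n X (rev a) *\<^sub>v (H i *\<^sub>v ?u)"
    using assms by (simp only: word_one_h)
  also have "H i *\<^sub>v ?u = (if b = [] then F (j # c) else 0) \<cdot>\<^sub>v \<phi> i"
    using k \<phi>[of i] by (subst H_mult[OF u]) (auto simp: \<phi>k kk)
  also have "word_eval n X (rev a) *\<^sub>v \<dots> = (if b = [] then F (j # c) else 0) \<cdot>\<^sub>v (word_eval n X (rev a) *\<^sub>v \<phi> i)"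
    using mult_mat_vec[OF WX \<phi>] .
  also have "\<dots> \<bullet> v = (if b = [] then F (j # c) else 0) * ((word_eval n X (rev a) *\<^sub>v \<phi> i) \<bullet> v)"
    using mult_mat_vec_carrier[OF WX \<phi>] v by (simp add: smult_scalar_prod_distrib[of _ n])
  also have "(word_eval n X (rev a) *\<^sub>v \<phi> i) \<bullet> v = F (i # a)"
    using word_eval_adjoint[OF X \<phi> v, of "rev a"] assms by (simp add: dual)
  finally show ?thesis by simp
qed

lemma keys_deriv:
  fixes p :: "'g ncpoly"
  shows "Poly_Mapping.keys (nc_deriv r p) \<subseteq> {w. length w \<le> nc_degree p}"
proof
  fix w assume "w \<in> Poly_Mapping.keys (nc_deriv r p)"
  then have "Poly_Mapping.lookup p (strip w) \<noteq> 0"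
    by (auto simp: in_keys_iff lookup_deriv split: if_splits)
  then show "w \<in> {w. length w \<le> nc_degree p}"
    using lookup_above_degree[of p "strip w"] by (auto simp flip: not_less)
qed

text \<open>The surviving words arise from nonempty words \<alpha> by turning the first letter into
  a direction. The test vector \<open>u\<close> is arbitrary so that the vanishing of the whole
  vector p'(X)[H]v can be deduced.\<close>

lemma eval_first_derivative:
  assumes d: "d = nc_degree p" and u: "u \<in> carrier_vec n"
  shows "(nc_eval n Y (nc_deriv 1 p) *\<^sub>v v) \<bullet> u
    = (\<Sum>\<alpha>\<in>index_words d. Poly_Mapping.lookup p \<alpha> * F \<alpha>) * (k \<bullet> u)"
proof -
  let ?S = "{w :: ('g + 'g) list. length w \<le> d}"
  let ?t = "\<lambda>w. Poly_Mapping.lookup (nc_deriv 1 p) w * ((word_eval n Y w *\<^sub>v v) \<bullet> u)"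
  let ?e = "\<lambda>\<alpha> :: 'g list. Inr (hd \<alpha>) # map Inl (tl \<alpha>) :: ('g + 'g) list"
  have "(nc_eval n Y (nc_deriv 1 p) *\<^sub>v v) \<bullet> u = (\<Sum>w\<in>?S. ?t w)"
    using v u keys_deriv[of 1 p] by (intro nc_eval_scalar_prod Yc) (auto simp: d)
  also have "\<dots> = (\<Sum>w\<in>?e ` index_words d. ?t w)"
  proof (intro sum.mono_neutral_right ballI)
    show "?e ` index_words d \<subseteq> ?S" by (auto simp: index_words_def Suc_le_eq)
    fix w assume w: "w \<in> ?S - ?e ` index_words d"
    show "?t w = 0"
    proof (cases "hcount w = 1")
      case True
      then obtain a j w' where w': "w = map Inl a @ Inr j # w'" "hcount w' = 0"
        using hcount_Suc[of w 0] by auto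
      then obtain c where c: "w = map Inl a @ Inr j # map Inl c" using hcount_0 by blast
      have "a \<noteq> []"
      proof
        assume "a = []"
        with w c have "j # c \<in> index_words d" "w = ?e (j # c)" by (auto simp: index_words_def)
        with w show False by blast
      qed
      moreover have "length c < d" using w c by auto
      ultimately show ?thesis using u word_one_h[of c a j] by (simp only: c) simp
    qed (simp add: lookup_deriv)
  qed simp
  also have "\<dots> = (\<Sum>\<alpha>\<in>index_words d. ?t (?e \<alpha>))"
  proof (subst sum.reindex)
    show "inj_on ?e (index_words d)"
      by (auto simp: inj_on_def index_words_def intro!: list.expand)
  qed simp
  also have "\<dots> = (\<Sum>\<alpha>\<in>index_words d. Poly_Mapping.lookup p \<alpha> * F \<alpha> * (k \<bullet> u))"
  proof (intro sum.cong refl)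
    fix \<alpha> :: "'g list" assume "\<alpha> \<in> index_words d"
    then have "\<alpha> \<noteq> []" "length (tl \<alpha>) < d"
      by (cases \<alpha>; simp add: index_words_def)+
    then show "?t (?e \<alpha>) = Poly_Mapping.lookup p \<alpha> * F \<alpha> * (k \<bullet> u)"
      using word_one_h[of "tl \<alpha>" "[]" "hd \<alpha>"] k u
      by (simp add: lookup_deriv smult_scalar_prod_distrib[of _ n] del: word_eval_Cons)
  qed
  finally show ?thesis by (simp add: sum_distrib_right)
qed

text \<open>The surviving words have adjacent direction letters and correspond to pairs (\<alpha>,
  \<beta>), the letters meeting at the junction of \<open>rev \<alpha> @ \<beta>\<close>. The factor
  2 is the factorial from differentiating twice.\<close>

lemma eval_second_derivative:
  assumes d: "d = nc_degree p"
  shows "(nc_eval n Y (nc_deriv 2 p) *\<^sub>v v) \<bullet> v = 2 * hankel_form p F"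
proof -
  let ?S = "{w :: ('g + 'g) list. length w \<le> d}"
  let ?W = "index_words d :: 'g list set"
  let ?P = "{(\<alpha>, \<beta>) \<in> ?W \<times> ?W. length \<alpha> + length \<beta> \<le> d}"
  let ?t = "\<lambda>w. Poly_Mapping.lookup (nc_deriv 2 p) w * ((word_eval n Y w *\<^sub>v v) \<bullet> v)"
  let ?e = "\<lambda>(\<alpha> :: 'g list, \<beta> :: 'g list).
    map Inl (rev (tl \<alpha>)) @ Inr (hd \<alpha>) # map Inl [] @ Inr (hd \<beta>) # map Inl (tl \<beta>) :: ('g + 'g) list"
  have "(nc_eval n Y (nc_deriv 2 p) *\<^sub>v v) \<bullet> v = (\<Sum>w\<in>?S. ?t w)"
    using v keys_deriv[of 2 p] by (intro nc_eval_scalar_prod Yc) (auto simp: d)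
  also have "\<dots> = (\<Sum>w\<in>?e ` ?P. ?t w)"
  proof (intro sum.mono_neutral_right ballI)
    show "?e ` ?P \<subseteq> ?S" by (auto simp: index_words_def Suc_le_eq)
    fix w assume w: "w \<in> ?S - ?e ` ?P"
    show "?t w = 0"
    proof (cases "hcount w = 2")
      case True
      then obtain a i w' where w': "w = map Inl a @ Inr i # w'" "hcount w' = 1"
        using hcount_Suc[of w 1] by auto
      then obtain b j w'' where w'': "w' = map Inl b @ Inr j # w''" "hcount w'' = 0"
        using hcount_Suc[of w' 0] by auto
      then obtain c where c: "w = map Inl (rev (rev a)) @ Inr i # map Inl b @ Inr j # map Inl c"
        using hcount_0[of w''] w' by auto
      have "b \<noteq> []"
      proof
        assume "b = []"
        with w c have "(i # rev a, j # c) \<in> ?P" "w = ?e (i # rev a, j # c)"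
          by (auto simp: index_words_def)
        with w show False by blast
      qed
      moreover have "length c < d" "length (rev a) < d" using w c by auto
      ultimately have "(word_eval n Y w *\<^sub>v v) \<bullet> v = 0" using word_two_h[of c "rev a" i b j] by (simp only: c) simp
      then show ?thesis by simp
    qed (simp add: lookup_deriv)
  qed simp
  also have "\<dots> = (\<Sum>x\<in>?P. ?t (?e x))"
  proof (subst sum.reindex)
    show "inj_on ?e ?P"
      by (auto simp: inj_on_def index_words_def map_Inl_append_inject intro!: list.expand)
  qed (simp add: o_def)
  also have "\<dots> = (\<Sum>(\<alpha>, \<beta>)\<in>?P. 2 * (Poly_Mapping.lookup p (rev \<alpha> @ \<beta>) * F \<alpha> * F \<beta>))"
  proof (intro sum.cong refl)
    fix x assume "x \<in> ?P"
    then obtain \<alpha> \<beta> where x\<alpha>\<beta>: "x = (\<alpha>, \<beta>)" "\<alpha> \<in> ?W" "\<beta> \<in> ?W" by auto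
    then have x: "x = (\<alpha>, \<beta>)" "\<alpha> \<noteq> []" "\<beta> \<noteq> []" "length (tl \<alpha>) < d" "length (tl \<beta>) < d"
      by (cases \<alpha>; cases \<beta>; simp add: index_words_def)+
    have "Poly_Mapping.lookup (nc_deriv 2 p) (?e x) = 2 * Poly_Mapping.lookup p (rev \<alpha> @ \<beta>)"
      using x by (cases \<alpha>; cases \<beta>) (auto simp: lookup_deriv rev_map[symmetric])
    moreover have "(word_eval n Y (?e x) *\<^sub>v v) \<bullet> v = F \<alpha> * F \<beta>"
      using word_two_h[of "tl \<beta>" "tl \<alpha>" "hd \<alpha>" "[]" "hd \<beta>"] x by (simp only: prod.case) simp
    ultimately show "?t (?e x) = (case x of (\<alpha>, \<beta>) \<Rightarrow> 2 * (Poly_Mapping.lookup p (rev \<alpha> @ \<beta>) * F \<alpha> * F \<beta>))"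
      by (simp only: x(1) prod.case)
  qed
  \<comment> \<open>The pairs added here have combined length above the degree, so their
    coefficients vanish.\<close>
  also have "\<dots> = (\<Sum>(\<alpha>, \<beta>)\<in>?W \<times> ?W. 2 * (Poly_Mapping.lookup p (rev \<alpha> @ \<beta>) * F \<alpha> * F \<beta>))"
    by (intro sum.mono_neutral_left) (auto simp: d intro!: lookup_above_degree)
  also have "\<dots> = 2 * hankel_form p F"
    by (simp add: hankel_form_def d sum_distrib_left sum.cartesian_product case_prod_beta)
  finally show ?thesis .
qed

text \<open>Since \<lambda> is chosen after \<delta>, its size is not controlled; the constraint on
  \<open>F\<close> makes p'(X)[H]v vanish, and the \<lambda> term with it. The rest is
  \<open>2 * hankel_form p F + \<delta> * C\<close> with \<open>C\<close> independent of \<delta>,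
  so a negative form is refuted by a small \<delta>.\<close>

lemma hankel_form_nonneg_if_hessian_positive:
  assumes d: "d = nc_degree p" and pos: "relaxed_hessian_positive_at p n (X, v)"
    and F: "(\<Sum>\<alpha>\<in>index_words d. Poly_Mapping.lookup p \<alpha> * F \<alpha>) = 0"
  shows "0 \<le> hankel_form p F"
proof (rule ccontr)
  assume neg: "\<not> 0 \<le> hankel_form p F"
  define R :: "('g + 'g) ncpoly" where "R = (\<Sum>j\<in>UNIV. \<Sum>m | length m < nc_degree p.
         nc_transpose (nc_word (map Inl m)) * nc_var (Inr j) ^ 2 * nc_word (map Inl m))"
  let ?E = "nc_eval n Y"
  define C where "C = (?E R *\<^sub>v v) \<bullet> v"
  \<comment> \<open>With this choice \<open>\<delta> * C\<close> is at most
    \<open>- hankel_form p F\<close>, only half of what would be needed to offset twice the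
    form.\<close>
  define \<delta> where "\<delta> = - hankel_form p F / (\<bar>C\<bar> + 1)"
  have "\<delta> > 0" using neg by (simp add: \<delta>_def field_simps)
  then obtain lam where lam: "(?E (relaxed_hessian lam \<delta> p) *\<^sub>v v) \<bullet> v \<ge> 0"
    using pos H by (auto simp: relaxed_hessian_positive_at_def)
  have p': "?E (nc_deriv 1 p) *\<^sub>v v = 0\<^sub>v n"
  proof (rule eq_vecI)
    fix i assume "i < dim_vec (0\<^sub>v n :: real vec)"
    then have i: "i < n" by simp
    have "(?E (nc_deriv 1 p) *\<^sub>v v) \<bullet> unit_vec n i = 0"
      using F by (subst eval_first_derivative[OF d]) simp_all
    then show "(?E (nc_deriv 1 p) *\<^sub>v v) $ i = 0\<^sub>v n $ i"
      using i by (simp add: scalar_prod_right_unit)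
  qed (use carrier_matD[OF nc_eval_carrier[of n Y]] in simp)
  have "?E (nc_transpose (nc_deriv 1 p) * nc_deriv 1 p) *\<^sub>v v
      = ?E (nc_transpose (nc_deriv 1 p)) *\<^sub>v (?E (nc_deriv 1 p) *\<^sub>v v)"
    by (simp only: nc_eval_mult[of Y, OF Yc] assoc_mult_mat_vec[OF nc_eval_carrier nc_eval_carrier v])
  also have "\<dots> = 0\<^sub>v n"
    unfolding p' by (rule mult_mat_zero_vec) (rule nc_eval_carrier)
  finally have "(?E (relaxed_hessian lam \<delta> p) *\<^sub>v v) \<bullet> v
      = (?E (nc_deriv 2 p) *\<^sub>v v + \<delta> \<cdot>\<^sub>v (?E R *\<^sub>v v) + lam \<cdot>\<^sub>v 0\<^sub>v n) \<bullet> v"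
    unfolding relaxed_hessian_def R_def[symmetric]
    using v by (simp add: nc_eval_add nc_eval_const_mult[of Y, OF Yc] smult_mat_mult_vec[of _ n n]
        add_mult_distrib_mat_vec[of _ n n])
  also have "\<dots> = 2 * hankel_form p F + \<delta> * C"
    using v mult_mat_vec_carrier[OF nc_eval_carrier[of n Y] v]
    by (simp add: add_scalar_prod_distrib[of _ n] smult_scalar_prod_distrib[of _ n] C_def
        eval_second_derivative[OF d])
  also have "\<dots> < 0"
  proof -
    have "\<delta> * C \<le> \<delta> * (\<bar>C\<bar> + 1)" using \<open>\<delta> > 0\<close> by (intro mult_left_mono) auto
    also have "\<dots> = - hankel_form p F" by (simp add: \<delta>_def add_nonneg_eq_0_iff)
    finally show ?thesis using neg by simp
  qed
  finally show False using lam by simp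
qed

end

section \<open>From positivity at a single point to the degree bound and convexity\<close>

theorem corollary1p6:
  fixes p :: "'g::finite ncpoly"
    and d :: nat
    and N :: "nat \<Rightarrow> ('g \<Rightarrow> real mat) \<Rightarrow> real"
  assumes symmetric: "nc_symmetric p"
    and degree: "nc_degree p = d"
    and norms: "\<And>n. n \<ge> 1 \<Longrightarrow> norm_on_sym_tuples n (N n)"
    and positive: "\<exists>\<epsilon>>0. relaxed_hessian_positive_on p (nc_neighborhood N \<epsilon>)"
  shows "d \<le> 2 \<and> nc_convex p"
proof -
  obtain \<epsilon> where \<epsilon>: "\<epsilon> > 0" and pos: "relaxed_hessian_positive_on p (nc_neighborhood N \<epsilon>)"
    using positive by blast
  obtain n and X :: "'g \<Rightarrow> real mat" and v k where n: "n \<ge> 1" and X: "X \<in> sym_tuples n"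
    and small: "N n X < \<epsilon>"
    and vk: "v \<in> carrier_vec n" "k \<in> carrier_vec n" "k \<bullet> k = 1" "v \<bullet> k = 0"
    and Xk: "\<And>j. X j *\<^sub>v k = 0\<^sub>v n"
    and dual: "\<And>f :: 'g list \<Rightarrow> real. \<exists>\<phi>\<in>carrier_vec n. \<phi> \<bullet> k = 0 \<and>
      (\<forall>m. length m < d \<longrightarrow> \<phi> \<bullet> (word_eval n X m *\<^sub>v v) = f m)"
    by (rule small_fock_space_tuple[OF norms \<epsilon>, of d]) blast+
  have at: "relaxed_hessian_positive_at p n (X, v)"
    using pos n X small vk by (auto simp: relaxed_hessian_positive_on_def nc_neighborhood_def)
  have constrained: "0 \<le> hankel_form p F"
    if F: "(\<Sum>\<alpha>\<in>index_words d. Poly_Mapping.lookup p \<alpha> * F \<alpha>) = 0" for F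
  proof -
    have "\<forall>j. \<exists>\<phi>\<in>carrier_vec n. \<phi> \<bullet> k = 0 \<and>
        (\<forall>m. length m < d \<longrightarrow> \<phi> \<bullet> (word_eval n X m *\<^sub>v v) = F (j # m))"
      by (intro allI dual)
    then obtain \<phi> where \<phi>: "\<And>j. \<phi> j \<in> carrier_vec n" "\<And>j. \<phi> j \<bullet> k = 0"
      "\<And>j m. length m < d \<Longrightarrow> \<phi> j \<bullet> (word_eval n X m *\<^sub>v v) = F (j # m)"
      by metis
    interpret rank_two_direction n d X v k F \<phi>
      by standard (use X vk Xk \<phi> in auto)
    show ?thesis
      using hankel_form_nonneg_if_hessian_positive[OF degree[symmetric] at F] .
  qed
  have nonneg: "0 \<le> hankel_form p F" for F
  proof (cases "d = 0")
    \<comment> \<open>In degree 0 there is no nonempty word of top length to adjust at, but the form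
      is an empty sum.\<close>
    case True
    then have "index_words (nc_degree p) = ({} :: 'g list set)" by (auto simp: index_words_def degree)
    then show ?thesis by (simp add: hankel_form_def)
  next
    case False
    then obtain \<gamma> where \<gamma>: "Poly_Mapping.lookup p \<gamma> \<noteq> 0" "length \<gamma> = nc_degree p"
      using degree_attained[of p] degree by auto
    moreover have "\<gamma> \<noteq> []" using \<gamma> False degree by auto
    ultimately show ?thesis
    proof (rule hankel_form_nonneg)
      fix F :: "'g list \<Rightarrow> real"
      assume "(\<Sum>\<alpha>\<in>index_words (nc_degree p). Poly_Mapping.lookup p \<alpha> * F \<alpha>) = 0"
      then show "0 \<le> hankel_form p F" unfolding degree by (rule constrained)
    qed
  qed
  have "nc_degree p \<le> 2" by (rule degree_le_2[OF symmetric nonneg])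
  moreover have "nc_convex p"
    using convex_if_quadratic_part_nonneg[OF symmetric \<open>nc_degree p \<le> 2\<close>]
      quadratic_part_nonneg[OF nonneg] by blast
  ultimately show ?thesis by (simp add: degree)
qed

end
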